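(* Let $K,T\subset\mathbb{R}^n$ be bounded strictly convex open sets with $C^6$-smooth boundaries. Assume that $\partial T$ is closed and has positive definite second fundamental form at every point. Assume that the $T$-billiard reflection $R_K=(R_{K,q})_{q\in\partial K}$ in $K$ is a projective billiard reflection, i.e. there exists a transversal line field $\mathcal N$ on $\partial K$ such that for every $q\in\partial K$ the map $R_{K,q}$ is the restriction to the lines directed out of $K$ at $q$ of the projective billiard reflection involution at $q$ defined by $(\partial K,\mathcal N)$. Then $\partial T$ is an ellipsoid.
   Context: Reflection $R_{K,q}$. For $q\in\partial K$ let $\vec n(q)$ be the exterior unit normal to $\partial K$ at $q$, and for $p\in\partial T$ let $\vec n(p)$ be the exterior unit normal to $\partial T$ at $p$. An oriented line through $q$ with direction vector $u$ is directed out of $K$ at $q$ if $\langle u,\vec n(q)\rangle>0$ and directed inside $K$ if $\langle u,\vec n(q)\rangle<0$. The map $R_{K,q}$ sends an oriented line $L_0$ through $q$ directed out of $K$ to an oriented line $L_1$ through $q$ directed inside $K$ as follows: let $p_0\in\partial T$ be the unique point such that $\vec n(p_0)$ is parallel to and co-directed with $L_0$; let $p_1\ne p_0$ be the second intersection point with $\partial T$ of the ray issued from $p_0$ in the direction $-\vec n(q)$; then $L_1$ is the oriented line through $q$ directed by $\vec n(p_1)$. (This is the reflection law of the projection to $K$ of the characteristic dynamics on $\partial(K\times T)\subset\mathbb{R}^{2n}$ with symplectic form $\sum_j dq_j\wedge dp_j$; the resulting dynamical system on oriented lines intersecting $K$ is called the $T$-billiard in $K$.) Projective billiard. A projective billiard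 is a smooth hypersurface $C\subset\mathbb{R}^n$ equipped with a transversal line field $\mathcal N$ (for each $Q\in C$, $\mathcal N(Q)$ is a line through $Q$ transversal to the tangent hyperplane $T_QC$). Its reflection involution at $Q\in C$ acts on the oriented lines through $Q$ by the affine involution $\mathbb{R}^n\to\mathbb{R}^n$ that fixes every point of the tangent hyperplane to $C$ at $Q$, preserves the line $\mathcal N(Q)$ and acts on $\mathcal N(Q)$ as the central symmetry with respect to $Q$. *)

theory Defs
  imports "HOL-Analysis.Analysis"
begin

definition strictly_convex :: "'a::real_normed_vector set \<Rightarrow> bool" where
  "strictly_convex D \<longleftrightarrow>
     (\<forall>x\<in>closure D. \<forall>y\<in>closure D. x \<noteq> y \<longrightarrow> open_segment x y \<subseteq> interior D)"

(* Meant for open U. *)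
primrec Ck_on :: "nat \<Rightarrow> ('a::real_normed_vector \<Rightarrow> real) \<Rightarrow> 'a set \<Rightarrow> bool" where
  "Ck_on 0 f U \<longleftrightarrow> continuous_on U f"
| "Ck_on (Suc k) f U \<longleftrightarrow>
     (\<forall>x\<in>U. f differentiable (at x)) \<and>
     (\<forall>v. Ck_on k (\<lambda>x. frechet_derivative f (at x) v) U)"

definition Ck_boundary :: "nat \<Rightarrow> 'a::real_normed_vector set \<Rightarrow> bool" where
  "Ck_boundary k D \<longleftrightarrow>
     (\<forall>q\<in>frontier D. \<exists>U f. open U \<and> q \<in> U \<and> Ck_on k f U \<and>
        (\<forall>x\<in>U. frechet_derivative f (at x) \<noteq> (\<lambda>v. 0)) \<and>
        D \<inter> U = {x\<in>U. f x < 0} \<and> frontier D \<inter> U = {x\<in>U. f x = 0})"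

(* The linear tangent space (velocities of curves in S through q); the affine tangent
   hyperplane of the hypersurface S at q is its translate by q. *)
definition tangent_space :: "'a::real_normed_vector set \<Rightarrow> 'a \<Rightarrow> 'a set" where
  "tangent_space S q =
     {v. \<exists>\<gamma>::real \<Rightarrow> 'a. \<gamma> 0 = q \<and> (\<forall>\<^sub>F t in nhds 0. \<gamma> t \<in> S) \<and>
           (\<gamma> has_vector_derivative v) (at 0)}"

definition exterior_normal :: "'a::real_inner set \<Rightarrow> 'a \<Rightarrow> 'a" where
  "exterior_normal D q =
     (THE \<nu>. norm \<nu> = 1 \<and> (\<forall>v\<in>tangent_space (frontier D) q. \<nu> \<bullet> v = 0) \<and>
             (\<forall>\<^sub>F t in at_right 0. q + t *\<^sub>R \<nu> \<notin> closure D))"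

(* II(v, w) = <dn(v), w> for v, w tangent to the boundary at p, where n is the exterior
   normal, so that the unit sphere has II(v, v) = <v, v>.  The derivative of n along the
   boundary is determined on tangent vectors only; second_fundamental_form is
   meaningful for these alone. *)
definition second_fundamental_form :: "'a::real_inner set \<Rightarrow> 'a \<Rightarrow> 'a \<Rightarrow> 'a \<Rightarrow> real" where
  "second_fundamental_form D p v w =
     frechet_derivative (exterior_normal D) (at p within frontier D) v \<bullet> w"

definition second_fundamental_form_pos_def :: "'a::real_inner set \<Rightarrow> 'a \<Rightarrow> bool" where
  "second_fundamental_form_pos_def D p \<longleftrightarrow>
     (\<forall>v\<in>tangent_space (frontier D) p. v \<noteq> 0 \<longrightarrow> second_fundamental_form D p v v > 0)"

definition line_through :: "'a::real_vector \<Rightarrow> 'a \<Rightarrow> 'a set" where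
  "line_through q u = {q + t *\<^sub>R u | t. True}"

(* An oriented line is the pair of its point set and its unit direction vector. *)
type_synonym 'a oline = "'a set \<times> 'a"

definition oline_through :: "'a::real_normed_vector \<Rightarrow> 'a \<Rightarrow> 'a oline" where
  "oline_through q u = (line_through q u, sgn u)"

definition olines_at :: "'a::real_normed_vector \<Rightarrow> 'a oline set" where
  "olines_at q = {oline_through q u | u. u \<noteq> 0}"

definition directed_out :: "'a::real_inner set \<Rightarrow> 'a \<Rightarrow> 'a oline \<Rightarrow> bool" where
  "directed_out K q L \<longleftrightarrow> L \<in> olines_at q \<and> snd L \<bullet> exterior_normal K q > 0"

definition T_billiard_reflection ::
  "'a::real_inner set \<Rightarrow> 'a set \<Rightarrow> 'a \<Rightarrow> 'a oline \<Rightarrow> 'a oline" where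
  "T_billiard_reflection T K q L =
     (let p0 = (THE p. p \<in> frontier T \<and> exterior_normal T p = snd L);
          p1 = (THE p. p \<in> frontier T \<and> p \<noteq> p0 \<and>
                       (\<exists>t\<ge>0. p = p0 + t *\<^sub>R (- exterior_normal K q)))
      in oline_through q (exterior_normal T p1))"

definition transversal_line_field :: "'a::real_normed_vector set \<Rightarrow> ('a \<Rightarrow> 'a set) \<Rightarrow> bool" where
  "transversal_line_field C N \<longleftrightarrow>
     (\<forall>q\<in>C. \<exists>v. v \<notin> tangent_space C q \<and> N q = line_through q v)"

definition affine_map :: "('a::real_vector \<Rightarrow> 'b::real_vector) \<Rightarrow> bool" where
  "affine_map A \<longleftrightarrow> (\<exists>l b. linear l \<and> A = (\<lambda>x. l x + b))"

definition projective_involution ::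
  "'a::real_normed_vector set \<Rightarrow> ('a \<Rightarrow> 'a set) \<Rightarrow> 'a \<Rightarrow> 'a \<Rightarrow> 'a" where
  "projective_involution C N q =
     (THE A. affine_map A \<and> A \<circ> A = id \<and>
             (\<forall>v\<in>tangent_space C q. A (q + v) = q + v) \<and>
             A ` N q = N q \<and> (\<forall>x\<in>N q. A x - q = - (x - q)))"

(* A (snd L) - A 0 is the linear part of the affine map A applied to the direction of L. *)
definition oline_image :: "('a::real_normed_vector \<Rightarrow> 'a) \<Rightarrow> 'a oline \<Rightarrow> 'a oline" where
  "oline_image A L = (A ` fst L, sgn (A (snd L) - A 0))"

definition ellipsoid :: "(real^'n) set \<Rightarrow> bool" where
  "ellipsoid S \<longleftrightarrow>
     (\<exists>(c::real^'n) (M::real^'n^'n).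
        transpose M = M \<and> (\<forall>x. x \<noteq> 0 \<longrightarrow> x \<bullet> (M *v x) > 0) \<and>
        S = {x. (x - c) \<bullet> (M *v (x - c)) = 1})"

end

theory Submission
  imports Defs
begin

text \<open>
  Fix a direction \<open>\<nu>\<close>; since the Gauss map of \<open>\<partial>K\<close> is onto, \<open>\<nu>\<close> is the normal at some \<open>q\<close>.  The
  projective involution at \<open>q\<close> has linear part \<open>A u = u - 2\<langle>u,\<nu>\<rangle>N\<close> with \<open>\<langle>N,\<nu>\<rangle> = 1\<close>, and the
  hypothesis says that the ends \<open>p, p'\<close> of each chord of \<open>T\<close> parallel to \<open>\<nu>\<close> satisfy
  \<open>n(p') \<parallel> A n(p)\<close>.  In terms of the support function \<open>H\<close> of \<open>T\<close>, the difference \<open>H \<circ> A - H\<close>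
  then has zero derivative along \<open>\<langle>u,\<nu>\<rangle> = 1\<close>, and its constant value is \<open>-\<langle>N, p + p'\<rangle>\<close>.  So
  the midpoints of all chords parallel to \<open>\<nu>\<close> lie in one hyperplane, and \<open>T\<close> has an affine
  reflection symmetry in every direction.  The affine symmetries of \<open>T\<close> therefore act transitively
  on \<open>\<partial>T\<close>; as they form a bounded group, they fix a point \<open>z\<close> and a positive definite
  quadratic form, so \<open>\<partial>T\<close> is a level set of that form around \<open>z\<close>.
\<close>

section \<open>Fixed points of bounded semigroups of affine maps\<close>

lemma affine_mapE:
  assumes "affine_map g"
  obtains l where "linear l" "\<And>x y. g x - g y = l (x - y)"
proof -
  from assms obtain l b where "linear l" "g = (\<lambda>x. l x + b)" unfolding affine_map_def by blast
  then show ?thesis using that[of l] by (simp add: linear_diff)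
qed

lemma affine_map_id [simp]: "affine_map id"
  unfolding affine_map_def by (intro exI[of _ "\<lambda>x. x"] exI[of _ 0]) (auto simp: linear_ident)

lemma affine_map_comp:
  assumes "affine_map g" "affine_map h"
  shows "affine_map (g \<circ> h)"
proof -
  from assms obtain l b l' b' where "linear l" "g = (\<lambda>x. l x + b)" "linear l'" "h = (\<lambda>x. l' x + b')"
    unfolding affine_map_def by blast
  then have "linear (l \<circ> l')" "g \<circ> h = (\<lambda>x. (l \<circ> l') x + (l b' + b))"
    by (auto simp: linear_compose linear_add)
  then show ?thesis unfolding affine_map_def by blast
qed

lemma affine_map_convex_comb:
  assumes "affine_map g" "u + v = (1::real)"
  shows "g (u *\<^sub>R x + v *\<^sub>R y) = u *\<^sub>R g x + v *\<^sub>R g y"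
proof -
  from assms(1) obtain l b where l: "linear l" "g = (\<lambda>x. l x + b)"
    unfolding affine_map_def by blast
  have b: "u *\<^sub>R b + v *\<^sub>R b = b" using assms(2) by (metis scaleR_add_left scaleR_one)
  have "g (u *\<^sub>R x + v *\<^sub>R y) = u *\<^sub>R l x + v *\<^sub>R l y + (u *\<^sub>R b + v *\<^sub>R b)"
    unfolding b using l by (simp add: linear_add linear_cmul)
  then show ?thesis using l(2) by (simp add: scaleR_add_right)
qed

lemma affine_map_inv:
  fixes g :: "'a::euclidean_space \<Rightarrow> 'a"
  assumes "affine_map g" "bij g"
  shows "affine_map (inv g)"
proof -
  from assms(1) obtain l b where l: "linear l" "g = (\<lambda>x. l x + b)"
    unfolding affine_map_def by blast
  have "inj l" using bij_is_inj[OF assms(2)] unfolding l(2) by (auto simp: inj_def)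
  have "bij l"
    by (simp add: \<open>inj l\<close> bij_betw_def l(1) linear_injective_imp_surjective)
  have li: "linear (inv l)"
    using \<open>inj l\<close> l(1) \<open>bij l\<close> by (simp add: inj_linear_imp_inv_linear)
  have "inv g = (\<lambda>x. inv l x + (- inv l b))"
  proof
    fix y
    have "g (inv l y + (- inv l b)) = y"
      using l li \<open>bij l\<close>
      by (simp add: linear_add linear_neg linear_diff bij_is_surj surj_f_inv_f)
    then show "inv g y = inv l y + (- inv l b)"
      by (metis assms(2) bij_inv_eq_iff)
  qed
  with li show ?thesis unfolding affine_map_def by blast
qed

text \<open>The parallelogram law. The deficit \<open>(dist x y)\<^sup>2 / 4\<close> supplies the
  strictness when two minimisers are averaged.\<close>

lemma norm_midpoint_sq:
  fixes x y :: "'a::real_inner"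
  shows "(norm ((1/2) *\<^sub>R x + (1/2) *\<^sub>R y))\<^sup>2 = ((norm x)\<^sup>2 + (norm y)\<^sup>2) / 2 - (dist x y)\<^sup>2 / 4"
  unfolding dist_norm power2_norm_eq_inner inner_diff_left inner_diff_right inner_add_left
    inner_add_right inner_scaleR_left inner_scaleR_right inner_commute[of y x]
  by (simp add: field_simps)

text \<open>The fixed point minimises \<open>sup\<^bsub>g \<in> G\<^esub> \<parallel>g x\<parallel>\<close>; the lower Lipschitz bound makes this function
  strictly convex along the midpoint of two minimisers.\<close>

lemma affine_semigroup_fixed_point:
  fixes G :: "('a::euclidean_space \<Rightarrow> 'a) set"
  assumes id: "id \<in> G" and comp: "\<And>g h. g \<in> G \<Longrightarrow> h \<in> G \<Longrightarrow> g \<circ> h \<in> G"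
    and aff: "\<And>g. g \<in> G \<Longrightarrow> affine_map g"
    and upper: "\<And>g x y. g \<in> G \<Longrightarrow> dist (g x) (g y) \<le> b * dist x y"
    and lower: "\<And>g x y. g \<in> G \<Longrightarrow> a * dist x y \<le> dist (g x) (g y)" and "a > 0" "b \<ge> 0"
    and C0: "compact C0" "convex C0" and orbit: "\<And>g. g \<in> G \<Longrightarrow> g x0 \<in> C0"
  shows "\<exists>x\<in>C0. \<forall>g\<in>G. g x = x"
proof -
  \<comment> \<open>Points whose whole orbit stays in \<open>C0\<close>. This set is still compact
    and closed under midpoints, and in addition every member of \<open>G\<close> maps it into
    itself.\<close>
  define C where "C = {x. \<forall>g\<in>G. g x \<in> C0}"
  have CC0: "C \<subseteq> C0" using id by (force simp: C_def)
  have contg: "continuous_on UNIV g" if "g \<in> G" for g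
    by (rule lipschitz_on_continuous_on[of b], rule lipschitz_onI) (rule upper[OF that], rule \<open>b \<ge> 0\<close>)
  have "closed C"
  proof -
    have "C = (\<Inter>g\<in>G. g -` C0)" by (auto simp: C_def)
    moreover have "closed (g -` C0)" if "g \<in> G" for g
      using contg[OF that] C0(1) by (simp add: closed_vimage compact_imp_closed)
    ultimately show ?thesis by auto
  qed
  then have "compact C" using CC0 C0(1) by (metis compact_Int_closed inf.absorb_iff2)
  have Cconv: "(1/2) *\<^sub>R x + (1/2) *\<^sub>R y \<in> C" if "x \<in> C" "y \<in> C" for x y
    unfolding C_def
  proof (clarify)
    fix g assume g: "g \<in> G"
    have "(1/2) *\<^sub>R g x + (1/2) *\<^sub>R g y \<in> C0"
      by (rule convexD[OF C0(2)]) (use that g in \<open>auto simp: C_def\<close>)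
    then show "g ((1/2) *\<^sub>R x + (1/2) *\<^sub>R y) \<in> C0"
      by (simp add: affine_map_convex_comb[OF aff[OF g]])
  qed
  have CG: "h x \<in> C" if "x \<in> C" "h \<in> G" for x h
    using that comp[OF _ that(2)] by (fastforce simp: C_def)
  define \<Phi> where "\<Phi> x = (SUP g\<in>G. norm (g x))" for x
  obtain B where B: "\<And>y. y \<in> C0 \<Longrightarrow> norm y \<le> B"
    using C0(1) compact_imp_bounded bounded_iff by metis
  have le\<Phi>: "norm (g x) \<le> \<Phi> x" if "x \<in> C" "g \<in> G" for x g
    unfolding \<Phi>_def
    by (rule cSUP_upper[OF that(2)]) (use that B in \<open>auto simp: C_def intro!: bdd_aboveI2[where M=B]\<close>)
  have \<Phi>le: "\<Phi> x \<le> c" if "\<And>g. g \<in> G \<Longrightarrow> norm (g x) \<le> c" for x c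
    unfolding \<Phi>_def using id that by (intro cSUP_least) auto
  have \<Phi>lip: "\<Phi> x \<le> \<Phi> y + b * dist x y" if "x \<in> C" "y \<in> C" for x y
  proof (rule \<Phi>le)
    fix g assume g: "g \<in> G"
    have "norm (g x) \<le> norm (g y) + dist (g x) (g y)"
      by (metis add.commute dist_norm norm_triangle_sub)
    then show "norm (g x) \<le> \<Phi> y + b * dist x y"
      using le\<Phi>[OF that(2) g] upper[OF g, of x y] by linarith
  qed
  have "continuous_on C \<Phi>"
  proof (rule lipschitz_on_continuous_on[of b], unfold lipschitz_on_def, intro conjI ballI \<open>b \<ge> 0\<close>)
    fix x y assume "x \<in> C" "y \<in> C"
    then show "dist (\<Phi> x) (\<Phi> y) \<le> b * dist x y"
      using \<Phi>lip[of x y] \<Phi>lip[of y x] by (simp add: dist_real_def dist_commute)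
  qed
  moreover have "x0 \<in> C" using orbit by (simp add: C_def)
  ultimately obtain x where x: "x \<in> C" "\<And>y. y \<in> C \<Longrightarrow> \<Phi> x \<le> \<Phi> y"
    using continuous_attains_inf[OF \<open>compact C\<close>] by (metis empty_iff)
  have "h x = x" if h: "h \<in> G" for h
  proof (rule ccontr)
    assume "h x \<noteq> x"
    define y where "y = h x"
    \<comment> \<open>By the lower Lipschitz bound, \<open>\<delta>\<close> is at most the
      parallelogram deficit of \<open>g x\<close> and \<open>g y\<close> for every \<open>g\<close>
      in \<open>G\<close> at once.\<close>
    define \<delta> where "\<delta> = (a * dist x y)\<^sup>2 / 4"
    have "\<delta> > 0" using \<open>h x \<noteq> x\<close> \<open>a > 0\<close> by (simp add: \<delta>_def y_def)
    have "y \<in> C" using CG x h by (simp add: y_def)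
    have "\<Phi> x \<ge> 0" using le\<Phi>[OF x(1) id] by (meson norm_ge_zero order_trans)
    define z where "z = (1/2) *\<^sub>R x + (1/2) *\<^sub>R y"
    have "z \<in> C" using Cconv x \<open>y \<in> C\<close> by (simp add: z_def)
    have "norm (g z) \<le> sqrt ((\<Phi> x)\<^sup>2 - \<delta>)" if g: "g \<in> G" for g
    proof (rule real_le_rsqrt)
      have 1: "norm (g x) \<le> \<Phi> x" using le\<Phi> x g by blast
      \<comment> \<open>Since \<open>g \<circ> h\<close> lies in \<open>G\<close>, the orbit of
        \<open>y = h x\<close> is part of the orbit of \<open>x\<close>.\<close>
      have 2: "norm (g y) \<le> \<Phi> x"
        using le\<Phi>[OF x(1) comp[OF g h]] by (simp add: y_def)
      have 3: "\<delta> \<le> (dist (g x) (g y))\<^sup>2 / 4"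
        unfolding \<delta>_def using lower[OF g, of x y] \<open>a > 0\<close>
        by (intro divide_right_mono power_mono) auto
      have "g z = (1/2) *\<^sub>R g x + (1/2) *\<^sub>R g y"
        unfolding z_def by (rule affine_map_convex_comb) (use aff g in auto)
      then have "(norm (g z))\<^sup>2 = ((norm (g x))\<^sup>2 + (norm (g y))\<^sup>2) / 2 - (dist (g x) (g y))\<^sup>2 / 4"
        by (simp only: norm_midpoint_sq)
      moreover have "(norm (g x))\<^sup>2 \<le> (\<Phi> x)\<^sup>2" "(norm (g y))\<^sup>2 \<le> (\<Phi> x)\<^sup>2"
        using 1 2 by (auto intro: power_mono)
      moreover have "A = (B + C) / 2 - D / 4 \<Longrightarrow> B \<le> P \<Longrightarrow> C \<le> P \<Longrightarrow> \<delta> \<le> D / 4 \<Longrightarrow> A \<le> P - \<delta>"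
        for A B C D P :: real by (simp add: field_simps)
      ultimately show "(norm (g z))\<^sup>2 \<le> (\<Phi> x)\<^sup>2 - \<delta>"
        using 3 by blast
    qed
    then have "\<Phi> z \<le> sqrt ((\<Phi> x)\<^sup>2 - \<delta>)" by (rule \<Phi>le)
    also have "\<dots> < sqrt ((\<Phi> x)\<^sup>2)" using \<open>\<delta> > 0\<close> by (simp only: real_sqrt_less_iff)
    also have "\<dots> = \<Phi> x" using \<open>\<Phi> x \<ge> 0\<close> by simp
    finally show False using x(2)[OF \<open>z \<in> C\<close>] by simp
  qed
  then show ?thesis using x(1) CC0 by blast
qed

section \<open>Norm estimates for matrices\<close>

lemma norm_matrix_le_sum_entries:
  fixes A :: "real^'n^'m"
  shows "norm A \<le> (\<Sum>i\<in>UNIV. \<Sum>j\<in>UNIV. \<bar>A $ i $ j\<bar>)"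
proof -
  have "norm A \<le> (\<Sum>i\<in>UNIV. norm (A $ i))" by (simp add: norm_vec_def L2_set_le_sum)
  also have "\<dots> \<le> (\<Sum>i\<in>UNIV. \<Sum>j\<in>UNIV. \<bar>A $ i $ j\<bar>)" by (intro sum_mono norm_le_l1_cart)
  finally show ?thesis .
qed

text \<open>Each entry is a coordinate of the image of a basis vector, hence at most
  \<open>b\<close> in absolute value. Summing crudely over entries treats the transpose in the same
  way.\<close>

lemma norm_matrix_le_of_bound:
  fixes A :: "real^'n^'m"
  assumes "\<And>x. norm (A *v x) \<le> b * norm x"
  shows "norm A \<le> real CARD('m) * real CARD('n) * b"
    and "norm (transpose A) \<le> real CARD('m) * real CARD('n) * b"
proof -
  have e: "\<bar>A $ i $ j\<bar> \<le> b" for i j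
  proof -
    have "\<bar>A $ i $ j\<bar> = \<bar>(A *v axis j 1) $ i\<bar>"
      by (simp add: matrix_vector_mult_basis column_def)
    also have "\<dots> \<le> norm (A *v axis j 1)" by (rule component_le_norm_cart)
    also have "\<dots> \<le> b" using assms[of "axis j 1"] by simp
    finally show ?thesis .
  qed
  have "(\<Sum>i\<in>UNIV. \<Sum>j\<in>UNIV. \<bar>A $ i $ j\<bar>) \<le> (\<Sum>i\<in>(UNIV::'m set). \<Sum>j\<in>(UNIV::'n set). b)"
    by (intro sum_mono e)
  then show "norm A \<le> real CARD('m) * real CARD('n) * b"
    using norm_matrix_le_sum_entries[of A] by simp
  have "(\<Sum>i\<in>UNIV. \<Sum>j\<in>UNIV. \<bar>transpose A $ i $ j\<bar>) \<le> (\<Sum>i\<in>(UNIV::'n set). \<Sum>j\<in>(UNIV::'m set). b)"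
    by (intro sum_mono) (simp add: e transpose_def)
  then show "norm (transpose A) \<le> real CARD('m) * real CARD('n) * b"
    using norm_matrix_le_sum_entries[of "transpose A"] by (simp add: mult_ac)
qed

text \<open>Matrix multiplication is bilinear on a finite-dimensional space, hence bounded; only the
  existence of the constant matters later.\<close>

lemma norm_matrix_mult_bound:
  obtains c where "c \<ge> 0"
    "\<And>(A::real^'n^'n) (B::real^'n^'n). norm (A ** B) \<le> c * norm A * norm B"
proof -
  have "bilinear (\<lambda>(A::real^'n^'n) (B::real^'n^'n). A ** B)"
    unfolding bilinear_def
    by (auto intro!: linearI simp: matrix_add_ldistrib scalar_matrix_assoc matrix_scalar_ac)
      (simp add: matrix_matrix_mult_def vec_eq_iff sum.distrib distrib_right)
  then obtain c where "c > 0" "\<And>(A::real^'n^'n) (B::real^'n^'n). norm (A ** B) \<le> c * norm A * norm B"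
    using bilinear_bounded_pos by blast
  then show ?thesis using that[of c] by auto
qed

section \<open>Affine symmetries of a bounded open set\<close>

definition affine_symmetries :: "'a::real_vector set \<Rightarrow> ('a \<Rightarrow> 'a) set" where
  "affine_symmetries T = {g. affine_map g \<and> bij g \<and> g ` T = T}"

lemma id_affine_symmetries: "id \<in> affine_symmetries T"
  by (simp add: affine_symmetries_def)

lemma comp_affine_symmetries:
  assumes "g \<in> affine_symmetries T" "h \<in> affine_symmetries T"
  shows "g \<circ> h \<in> affine_symmetries T"
proof -
  have "(g \<circ> h) ` T = T" using assms unfolding affine_symmetries_def image_comp[symmetric] by simp
  then show ?thesis using assms by (auto simp: affine_symmetries_def affine_map_comp bij_comp)
qed

lemma inv_affine_symmetries:
  fixes T :: "'a::euclidean_space set"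
  assumes "g \<in> affine_symmetries T"
  shows "inv g \<in> affine_symmetries T"
proof -
  have "inv g ` T = T"
    using assms image_inv_f_f[OF bij_is_inj, of g T] by (simp add: affine_symmetries_def)
  then show ?thesis using assms by (simp add: affine_symmetries_def affine_map_inv bij_imp_bij_inv)
qed

text \<open>A ball of radius \<open>r\<close> inside \<open>T\<close> is mapped into
  \<open>T\<close>, where norms are at most \<open>R\<close>. This bounds the linear part of a
  symmetry independently of the symmetry.\<close>

lemma affine_symmetries_lipschitz:
  fixes T :: "'a::euclidean_space set"
  assumes "open T" "bounded T" "T \<noteq> {}"
  obtains b where "b > 0" "\<And>g x y. g \<in> affine_symmetries T \<Longrightarrow> dist (g x) (g y) \<le> b * dist x y"
proof -
  obtain p where "p \<in> T" using assms(3) by blast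
  with assms(1) obtain r where pr: "r > 0" "ball p r \<subseteq> T"
    using open_contains_ball by blast
  from assms(2) obtain R where R: "R > 0" "\<And>x. x \<in> T \<Longrightarrow> norm x \<le> R"
    by (meson bounded_pos)
  have "dist (g x) (g y) \<le> (4 * R / r) * dist x y" if g: "g \<in> affine_symmetries T" for g x y
  proof (cases "x = y")
    case False
    obtain l where l: "linear l" "\<And>x y. g x - g y = l (x - y)"
      using g affine_mapE unfolding affine_symmetries_def by blast
    define d where "d = dist x y"
    have "d > 0" using False by (simp add: d_def)
    define w where "w = (r / (2 * d)) *\<^sub>R (x - y)"
    have "norm w = r / 2" using \<open>d > 0\<close> pr(1) by (simp add: w_def d_def dist_norm)
    then have "p + w \<in> T" "p \<in> T" using pr by (auto simp: dist_norm)
    then have "g (p + w) \<in> T" "g p \<in> T" using g by (auto simp: affine_symmetries_def)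
    then have "norm (g (p + w)) \<le> R" "norm (g p) \<le> R" using R(2) by auto
    then have "norm (g (p + w) - g p) \<le> 2 * R"
      using norm_triangle_ineq4[of "g (p + w)" "g p"] by linarith
    then have "norm (l w) \<le> 2 * R" by (simp add: l)
    also have "l w = (r / (2 * d)) *\<^sub>R (g x - g y)" by (simp add: w_def l linear_cmul)
    finally have "r / (2 * d) * dist (g x) (g y) \<le> 2 * R"
      using pr(1) \<open>d > 0\<close> by (simp add: dist_norm)
    then show ?thesis using pr(1) \<open>d > 0\<close> by (simp add: d_def[symmetric] field_simps)
  qed simp
  then show ?thesis using that[of "4 * R / r"] pr(1) R(1) by auto
qed

lemma two_frontier_points_on_line:
  fixes T :: "'a::euclidean_space set"
  assumes "open T" "bounded T" "x \<in> T" "v \<noteq> 0"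
  obtains d e where "d > 0" "e > 0" "x + d *\<^sub>R v \<in> frontier T" "x - e *\<^sub>R v \<in> frontier T"
    "\<And>s. - e < s \<Longrightarrow> s < d \<Longrightarrow> x + s *\<^sub>R v \<in> T"
proof -
  have int: "x \<in> interior T" using assms by (simp add: interior_open)
  obtain d where d: "0 < d" "x + d *\<^sub>R v \<in> frontier T"
    "\<And>s. 0 \<le> s \<Longrightarrow> s < d \<Longrightarrow> x + s *\<^sub>R v \<in> interior T"
    using ray_to_frontier[OF assms(2) int assms(4)] by blast
  have "- v \<noteq> 0" using assms(4) by simp
  then obtain e where e: "0 < e" "x + e *\<^sub>R (- v) \<in> frontier T"
    "\<And>s. 0 \<le> s \<Longrightarrow> s < e \<Longrightarrow> x + s *\<^sub>R (- v) \<in> interior T"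
    using ray_to_frontier[OF assms(2) int] by blast
  have "x + s *\<^sub>R v \<in> T" if "- e < s" "s < d" for s
  proof (cases "s \<ge> 0")
    case True
    then show ?thesis using d(3)[of s] that interior_subset by blast
  next
    case False
    then have "x + (- s) *\<^sub>R (- v) \<in> interior T" using that by (intro e(3)) auto
    then show ?thesis using interior_subset by auto
  qed
  then show ?thesis using that[of d e] d e by simp
qed

text \<open>By \<open>mid\<close> the hyperplane \<open>N \<bullet> x = c\<close> bisects every
  chord parallel to \<open>\<nu>\<close>. The affine involution fixing that hyperplane and reversing
  \<open>\<nu>\<close> therefore flips each of these chords about its midpoint.\<close>

lemma chord_reflection:
  fixes T :: "'a::euclidean_space set"
  assumes "open T" "bounded T" "norm \<nu> = 1" "N \<bullet> \<nu> = 1"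
    and mid: "\<And>p q t. p \<in> frontier T \<Longrightarrow> q \<in> frontier T \<Longrightarrow> t > 0 \<Longrightarrow> p - q = t *\<^sub>R \<nu> \<Longrightarrow> N \<bullet> (p + q) = 2 * c"
  shows "(\<lambda>x. x - (2 * (N \<bullet> x - c)) *\<^sub>R \<nu>) \<in> affine_symmetries T" (is "?S \<in> _")
    and "\<And>p q t. p \<in> frontier T \<Longrightarrow> q \<in> frontier T \<Longrightarrow> t > 0 \<Longrightarrow> p - q = t *\<^sub>R \<nu> \<Longrightarrow>
           p - (2 * (N \<bullet> p - c)) *\<^sub>R \<nu> = q"
proof -
  have inv: "?S (?S x) = x" for x
    using assms(4) by (simp add: inner_diff_right algebra_simps)
  have "bij ?S" by (rule o_bij[of ?S]) (use inv in \<open>auto simp: fun_eq_iff\<close>)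
  have "linear (\<lambda>x. x - (2 * (N \<bullet> x)) *\<^sub>R \<nu>)"
    by (rule linearI) (auto simp: inner_add_right algebra_simps)
  moreover have "?S = (\<lambda>x. (\<lambda>x. x - (2 * (N \<bullet> x)) *\<^sub>R \<nu>) x + (2 * c) *\<^sub>R \<nu>)"
    by (auto simp: algebra_simps)
  ultimately have "affine_map ?S" unfolding affine_map_def by blast
  have ST: "?S x \<in> T" if x: "x \<in> T" for x
  proof -
    have "\<nu> \<noteq> 0" using assms(3) by auto
    then obtain d e where de: "d > 0" "e > 0" "x + d *\<^sub>R \<nu> \<in> frontier T" "x - e *\<^sub>R \<nu> \<in> frontier T"
      "\<And>s. - e < s \<Longrightarrow> s < d \<Longrightarrow> x + s *\<^sub>R \<nu> \<in> T"
      using two_frontier_points_on_line[OF assms(1,2) x] by metis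
    have "N \<bullet> ((x + d *\<^sub>R \<nu>) + (x - e *\<^sub>R \<nu>)) = 2 * c"
      by (rule mid[OF de(3,4), of "d + e"]) (use de(1,2) in \<open>auto simp: algebra_simps\<close>)
    then have "2 * (N \<bullet> x - c) = e - d"
      using assms(4) by (simp add: inner_add_right inner_diff_right)
    \<comment> \<open>The chord through \<open>x\<close> has parameters from \<open>- e\<close> to
      \<open>d\<close>, so its midpoint is at \<open>(d - e) / 2\<close> and the mirror image of
      \<open>x\<close> is at \<open>d - e\<close>.\<close>
    then have "?S x = x + (d - e) *\<^sub>R \<nu>" by (simp only: scaleR_diff_left) simp
    moreover have "x + (d - e) *\<^sub>R \<nu> \<in> T" by (rule de(5)) (use de(1,2) in auto)
    ultimately show ?thesis by (simp only:)
  qed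
  have "?S ` T = T"
  proof
    show "?S ` T \<subseteq> T" using ST by blast
    show "T \<subseteq> ?S ` T"
    proof
      fix x assume "x \<in> T"
      then show "x \<in> ?S ` T" using inv[of x] ST by (intro image_eqI[of _ _ "?S x"]) auto
    qed
  qed
  with \<open>affine_map ?S\<close> \<open>bij ?S\<close> show "?S \<in> affine_symmetries T"
    by (simp add: affine_symmetries_def)
  fix p q t assume pq: "p \<in> frontier T" "q \<in> frontier T" "t > 0" "p - q = t *\<^sub>R \<nu>"
  have q: "q = p - t *\<^sub>R \<nu>" using pq(4) by (simp add: algebra_simps)
  have "N \<bullet> (p + q) = 2 * c" using mid pq by blast
  then have "2 * (N \<bullet> p - c) = t" using assms(4) by (simp add: q inner_add_right inner_diff_right)
  then show "p - (2 * (N \<bullet> p - c)) *\<^sub>R \<nu> = q" by (simp add: q)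
qed

text \<open>The uniform Lipschitz bound, applied to \<open>g\<close> and to its inverse, gives both
  estimates of the fixed point lemma. Orbits of points of \<open>T\<close> stay in the compact
  convex set \<open>closure T\<close>.\<close>

lemma affine_symmetries_fixed_point:
  fixes T :: "'a::euclidean_space set"
  assumes "open T" "bounded T" "T \<noteq> {}" "convex T"
  shows "\<exists>z\<in>closure T. \<forall>g\<in>affine_symmetries T. g z = z"
proof -
  obtain b where b: "b > 0" "\<And>g x y. g \<in> affine_symmetries T \<Longrightarrow> dist (g x) (g y) \<le> b * dist x y"
    using affine_symmetries_lipschitz[OF assms(1-3)] by metis
  obtain x0 where "x0 \<in> T" using assms(3) by blast
  show ?thesis
  proof (rule affine_semigroup_fixed_point[where b=b and a="1/b" and ?x0.0=x0])
    fix g x y assume g: "g \<in> affine_symmetries T"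
    have "dist (inv g (g x)) (inv g (g y)) \<le> b * dist (g x) (g y)"
      using b(2) inv_affine_symmetries[OF g] by blast
    moreover have "inj g" using g by (simp add: affine_symmetries_def bij_is_inj)
    ultimately show "1 / b * dist x y \<le> dist (g x) (g y)"
      using b(1) by (simp add: field_simps)
  next
    fix g assume g: "g \<in> affine_symmetries T"
    then have "g x0 \<in> T" using \<open>x0 \<in> T\<close> by (auto simp: affine_symmetries_def)
    then show "g x0 \<in> closure T" using closure_subset by blast
  next
    show "affine_map g" if "g \<in> affine_symmetries T" for g
      using that by (simp add: affine_symmetries_def)
  qed (use b assms in \<open>auto simp: id_affine_symmetries comp_affine_symmetries convex_closure\<close>)
qed

section \<open>Invariant quadratic forms of bounded matrix groups\<close>

lemma dot_transpose_matrix_mul: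
  fixes A :: "real^'n^'n"
  shows "x \<bullet> (transpose A *v y) = (A *v x) \<bullet> y"
  by (metis dot_lmul_matrix inner_commute vector_transpose_matrix)

lemma congruence_transpose:
  fixes L Q :: "real^'n^'n"
  assumes "transpose Q = Q"
  shows "transpose (transpose L ** Q ** L) = transpose L ** Q ** L"
  using assms by (simp add: matrix_transpose_mul matrix_mul_assoc)

text \<open>The group acts linearly on matrices by congruence, with uniform bounds in both
  directions. The fixed point lemma, applied to the orbit of the identity matrix, takes the place of
  averaging over the group.\<close>

lemma invariant_form:
  fixes \<L> :: "(real^'n^'n) set"
  assumes id: "mat 1 \<in> \<L>" and comp: "\<And>K L. K \<in> \<L> \<Longrightarrow> L \<in> \<L> \<Longrightarrow> K ** L \<in> \<L>"
    and inv: "\<And>L. L \<in> \<L> \<Longrightarrow> \<exists>K\<in>\<L>. L ** K = mat 1"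
    and bound: "\<And>L x. L \<in> \<L> \<Longrightarrow> norm (L *v x) \<le> b * norm x" and "b > 0"
  obtains M where "transpose M = M" "\<And>x. x \<noteq> 0 \<Longrightarrow> x \<bullet> (M *v x) > 0"
    "\<And>L x. L \<in> \<L> \<Longrightarrow> (L *v x) \<bullet> (M *v (L *v x)) = x \<bullet> (M *v x)"
proof -
  obtain c where c: "c \<ge> 0" "\<And>(A::real^'n^'n) (B::real^'n^'n). norm (A ** B) \<le> c * norm A * norm B"
    using norm_matrix_mult_bound by metis
  define m where "m = real CARD('n) * real CARD('n) * b"
  have m: "norm L \<le> m" "norm (transpose L) \<le> m" if "L \<in> \<L>" for L
    using norm_matrix_le_of_bound[OF bound[OF that]] by (auto simp: m_def)
  have "m \<ge> 0" using \<open>b > 0\<close> by (simp add: m_def)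
  have inv2: "\<exists>K\<in>\<L>. L ** K = mat 1 \<and> K ** L = mat 1" if "L \<in> \<L>" for L
    using inv[OF that] matrix_left_right_inverse by blast
  have cong_bound: "norm (transpose L ** Q ** L) \<le> (c * m)\<^sup>2 * norm Q" if "L \<in> \<L>" for L Q
  proof -
    have "norm (transpose L ** Q ** L) \<le> c * norm (transpose L ** Q) * norm L" by (rule c)
    also have "\<dots> \<le> c * (c * norm (transpose L) * norm Q) * norm L"
      using c by (intro mult_right_mono mult_left_mono) auto
    also have "\<dots> \<le> c * (c * m * norm Q) * m"
      using c m[OF that] \<open>m \<ge> 0\<close> by (intro mult_mono mult_left_mono mult_right_mono) auto
    finally show ?thesis by (simp add: power2_eq_square mult_ac)
  qed
  define \<phi> where "\<phi> L Q = transpose L ** Q ** L" for L Q :: "real^'n^'n"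
  \<comment> \<open>Congruence reverses products; this is harmless because \<open>\<L>\<close> is
    closed under products in either order.\<close>
  have \<phi>comp: "\<phi> L (\<phi> K Q) = \<phi> (K ** L) Q" for K L Q
    by (simp add: \<phi>_def matrix_transpose_mul matrix_mul_assoc)
  have \<phi>lin: "linear (\<phi> L)" for L
    unfolding \<phi>_def
  proof (rule linearI)
    fix A B :: "real^'n^'n" and r :: real
    show "transpose L ** (A + B) ** L = transpose L ** A ** L + transpose L ** B ** L"
      by (simp add: matrix_add_ldistrib)
        (simp add: matrix_matrix_mult_def vec_eq_iff sum.distrib distrib_right)
    show "transpose L ** (r *\<^sub>R A) ** L = r *\<^sub>R (transpose L ** A ** L)"
      by (simp add: scalar_matrix_assoc matrix_scalar_ac)
  qed
  have lip: "norm (\<phi> L Q) \<le> ((c * m)\<^sup>2 + 1) * norm Q" if "L \<in> \<L>" for L Q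
  proof -
    have "(c * m)\<^sup>2 * norm Q \<le> ((c * m)\<^sup>2 + 1) * norm Q"
      by (intro mult_right_mono) auto
    then show ?thesis using cong_bound[OF that, of Q] by (simp add: \<phi>_def)
  qed
  \<comment> \<open>The summand 1 keeps \<open>k\<close> positive even if \<open>c * m = 0\<close>,
    so that \<open>1 / k\<close> can serve as lower Lipschitz constant.\<close>
  define k where "k = (c * m)\<^sup>2 + 1"
  have "k > 0" unfolding k_def by (simp add: add_nonneg_pos)
  have lower: "1 / k * norm Q \<le> norm (\<phi> L Q)" if "L \<in> \<L>" for L Q
  proof -
    obtain K where K: "K \<in> \<L>" "L ** K = mat 1" using inv[OF \<open>L \<in> \<L>\<close>] by blast
    then have "norm Q = norm (\<phi> K (\<phi> L Q))" unfolding \<phi>comp by (simp add: \<phi>_def)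
    also have "\<dots> \<le> k * norm (\<phi> L Q)" unfolding k_def by (rule lip) (rule K)
    finally show ?thesis using \<open>k > 0\<close> by (simp add: field_simps)
  qed
  have lower_vec: "(1 / b)\<^sup>2 * (x \<bullet> x) \<le> (L *v x) \<bullet> (L *v x)" if "L \<in> \<L>" for L x
  proof -
    obtain K where K: "K \<in> \<L>" "K ** L = mat 1" using inv2[OF \<open>L \<in> \<L>\<close>] by blast
    then have "norm x = norm (K *v (L *v x))" by (simp add: matrix_vector_mul_assoc)
    also have "\<dots> \<le> b * norm (L *v x)" by (rule bound) (rule K)
    finally have "1 / b * norm x \<le> norm (L *v x)" using \<open>b > 0\<close> by (simp add: field_simps)
    then have "(1 / b * norm x)\<^sup>2 \<le> (norm (L *v x))\<^sup>2" using \<open>b > 0\<close> by (intro power_mono) auto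
    then show ?thesis by (simp only: power_mult_distrib power2_norm_eq_inner)
  qed
  \<comment> \<open>A compact convex set containing the orbit of the identity. Its last condition
    comes from \<open>lower_vec\<close> and makes every member positive definite, so that the fixed
    point cannot degenerate.\<close>
  define C0 where "C0 = {Q::real^'n^'n. transpose Q = Q \<and> norm Q \<le> (c * m)\<^sup>2 * norm (mat 1 :: real^'n^'n) \<and>
      (\<forall>x. (1 / b)\<^sup>2 * (x \<bullet> x) \<le> x \<bullet> (Q *v x))}"
  have lin_form: "linear (\<lambda>Q::real^'n^'n. x \<bullet> (Q *v x))" for x
    by (rule linearI)
      (simp_all add: matrix_vector_mult_add_rdistrib inner_add_right flip: scaleR_matrix_vector_assoc)
  have lin_tr: "linear (transpose :: real^'n^'n \<Rightarrow> real^'n^'n)"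
    by (rule linearI) (simp_all add: transpose_def vec_eq_iff)
  have "closed C0"
  proof -
    have cl1: "closed {Q::real^'n^'n. transpose Q = Q}"
      by (intro closed_Collect_eq linear_continuous_on linear_linear[THEN iffD1] lin_tr continuous_on_id)
         (simp add: lin_tr linear_conv_bounded_linear[symmetric])
    have cl2: "closed {Q::real^'n^'n. (1 / b)\<^sup>2 * (x \<bullet> x) \<le> x \<bullet> (Q *v x)}" for x
      by (intro closed_Collect_le continuous_on_const linear_continuous_on)
         (simp add: lin_form linear_conv_bounded_linear[symmetric])
    have "closed {Q::real^'n^'n. norm Q \<le> (c * m)\<^sup>2 * norm (mat 1 :: real^'n^'n)}"
      by (intro closed_Collect_le continuous_intros)
    then show ?thesis
      unfolding C0_def using cl1 cl2 by (intro closed_Collect_conj closed_Collect_all)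
  qed
  moreover have "bounded C0" unfolding bounded_iff C0_def by blast
  ultimately have "compact C0" by (simp add: compact_eq_bounded_closed)
  have "convex C0"
  proof (rule convexI)
    fix P Q :: "real^'n^'n" and u v :: real
    assume PQ: "P \<in> C0" "Q \<in> C0" and uv: "0 \<le> u" "0 \<le> v" "u + v = 1"
    have "transpose (u *\<^sub>R P + v *\<^sub>R Q) = u *\<^sub>R P + v *\<^sub>R Q"
      using PQ by (simp add: linear_add[OF lin_tr] linear_cmul[OF lin_tr] C0_def)
    moreover have "norm (u *\<^sub>R P + v *\<^sub>R Q) \<le> (c * m)\<^sup>2 * norm (mat 1 :: real^'n^'n)"
    proof -
      have "norm (u *\<^sub>R P + v *\<^sub>R Q) \<le> u * norm P + v * norm Q"
        using norm_triangle_ineq[of "u *\<^sub>R P" "v *\<^sub>R Q"] uv by simp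
      also have "\<dots> \<le> (c * m)\<^sup>2 * norm (mat 1 :: real^'n^'n)"
        by (rule convex_bound_le) (use PQ uv in \<open>auto simp: C0_def\<close>)
      finally show ?thesis .
    qed
    moreover have "(1 / b)\<^sup>2 * (x \<bullet> x) \<le> x \<bullet> ((u *\<^sub>R P + v *\<^sub>R Q) *v x)" for x
    proof -
      have "u * ((1 / b)\<^sup>2 * (x \<bullet> x)) + v * ((1 / b)\<^sup>2 * (x \<bullet> x)) \<le> u * (x \<bullet> (P *v x)) + v * (x \<bullet> (Q *v x))"
        using PQ uv unfolding C0_def by (intro add_mono mult_left_mono) auto
      then show ?thesis
        using uv(3) by (simp add: linear_add[OF lin_form] linear_cmul[OF lin_form] flip: distrib_right)
    qed
    ultimately show "u *\<^sub>R P + v *\<^sub>R Q \<in> C0" by (simp add: C0_def)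
  qed
  have form: "x \<bullet> (\<phi> L Q *v x) = (L *v x) \<bullet> (Q *v (L *v x))" for x L Q
    unfolding \<phi>_def matrix_vector_mul_assoc[symmetric] dot_transpose_matrix_mul ..
  have orbit: "\<phi> L (mat 1) \<in> C0" if "L \<in> \<L>" for L
    unfolding C0_def
    using cong_bound[OF that, of "mat 1"] lower_vec[OF that] congruence_transpose[of "mat 1" L] form[of _ L "mat 1"]
    by (simp add: \<phi>_def)
  have "\<exists>M\<in>C0. \<forall>g\<in>\<phi> ` \<L>. g M = M"
  proof (rule affine_semigroup_fixed_point[where b=k and a="1/k" and ?x0.0="mat 1"])
    have "\<phi> (mat 1) = id" by (auto simp: \<phi>_def fun_eq_iff)
    then show "id \<in> \<phi> ` \<L>" using id by force
    show "g \<circ> h \<in> \<phi> ` \<L>" if "g \<in> \<phi> ` \<L>" "h \<in> \<phi> ` \<L>" for g h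
    proof -
      from that obtain K L where "K \<in> \<L>" "L \<in> \<L>" "g = \<phi> K" "h = \<phi> L" by blast
      moreover have "\<phi> K \<circ> \<phi> L = \<phi> (L ** K)" by (simp add: fun_eq_iff \<phi>comp)
      ultimately show ?thesis using comp by auto
    qed
    show "affine_map g" if "g \<in> \<phi> ` \<L>" for g
      unfolding affine_map_def using that \<phi>lin by (metis add.right_neutral imageE)
    show "dist (g x) (g y) \<le> k * dist x y" if "g \<in> \<phi> ` \<L>" for g x y
      using that lip by (auto simp: dist_norm k_def simp flip: linear_diff[OF \<phi>lin])
    show "1 / k * dist x y \<le> dist (g x) (g y)" if "g \<in> \<phi> ` \<L>" for g x y
      using that lower by (auto simp only: dist_norm simp flip: linear_diff[OF \<phi>lin])
    show "g (mat 1) \<in> C0" if "g \<in> \<phi> ` \<L>" for g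
      using that orbit by blast
  qed (use \<open>k > 0\<close> \<open>compact C0\<close> \<open>convex C0\<close> in auto)
  then obtain M where M: "M \<in> C0" "\<And>L. L \<in> \<L> \<Longrightarrow> \<phi> L M = M" by blast
  show ?thesis
  proof (rule that[of M])
    show "transpose M = M" using M(1) by (simp add: C0_def)
    show "x \<bullet> (M *v x) > 0" if "x \<noteq> 0" for x
    proof -
      have "0 < (1 / b)\<^sup>2 * (x \<bullet> x)" using that \<open>b > 0\<close> by simp
      also have "\<dots> \<le> x \<bullet> (M *v x)" using M(1) unfolding C0_def by blast
      finally show ?thesis .
    qed
    show "(L *v x) \<bullet> (M *v (L *v x)) = x \<bullet> (M *v x)" if "L \<in> \<L>" for L x
      using form[of x L M] M(2)[OF that] by simp
  qed
qed

section \<open>From chord symmetries to the ellipsoid\<close>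

lemma ellipsoid_if_chord_midpoints_coplanar:
  fixes T :: "(real^'n) set"
  assumes T: "open T" "bounded T" "T \<noteq> {}" "convex T"
    and chords: "\<And>\<nu>. norm \<nu> = 1 \<Longrightarrow> \<exists>N c. N \<bullet> \<nu> = 1 \<and>
      (\<forall>p\<in>frontier T. \<forall>q\<in>frontier T. \<forall>t>0. p - q = t *\<^sub>R \<nu> \<longrightarrow> N \<bullet> (p + q) = 2 * c)"
  shows "ellipsoid (frontier T)"
proof -
  have swap: "\<exists>g\<in>affine_symmetries T. g p = q" if pq: "p \<in> frontier T" "q \<in> frontier T" "p \<noteq> q" for p q
  proof -
    define \<nu> where "\<nu> = sgn (p - q)"
    have \<nu>: "norm \<nu> = 1" using pq(3) by (simp add: \<nu>_def norm_sgn)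
    have diff: "p - q = norm (p - q) *\<^sub>R \<nu>" using pq(3) by (simp add: \<nu>_def sgn_div_norm)
    obtain N c where N: "N \<bullet> \<nu> = 1"
      "\<And>p q t. p \<in> frontier T \<Longrightarrow> q \<in> frontier T \<Longrightarrow> t > 0 \<Longrightarrow> p - q = t *\<^sub>R \<nu> \<Longrightarrow> N \<bullet> (p + q) = 2 * c"
      using chords[OF \<nu>] by blast
    have "p - (2 * (N \<bullet> p - c)) *\<^sub>R \<nu> = q"
      by (rule chord_reflection(2)[OF T(1,2) \<nu> N(1) N(2) pq(1,2) _ diff]) (use pq(3) in auto)
    moreover have "(\<lambda>x. x - (2 * (N \<bullet> x - c)) *\<^sub>R \<nu>) \<in> affine_symmetries T"
      by (rule chord_reflection(1)[OF T(1,2) \<nu> N(1)]) (rule N(2))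
    ultimately show ?thesis by (rule bexI)
  qed
  obtain z where z: "z \<in> closure T" "\<And>g. g \<in> affine_symmetries T \<Longrightarrow> g z = z"
    using affine_symmetries_fixed_point[OF T] by blast
  \<comment> \<open>Otherwise \<open>z\<close> is a frontier point fixed by all symmetries, while
    \<open>swap\<close> moves it to any other frontier point. A line through a point of
    \<open>T\<close> meets the frontier twice, so another one exists.\<close>
  have "z \<in> T"
  proof (rule ccontr)
    assume "z \<notin> T"
    then have zf: "z \<in> frontier T" using z(1) T(1) by (simp add: frontier_def interior_open)
    obtain x where "x \<in> T" using T(3) by blast
    obtain v :: "real^'n" where "v \<noteq> 0" using vector_choose_size[of 1] by (metis norm_zero zero_neq_one zero_le_one)
    obtain d e where de: "d > 0" "e > 0" "x + d *\<^sub>R v \<in> frontier T" "x - e *\<^sub>R v \<in> frontier T"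
      using two_frontier_points_on_line[OF T(1,2) \<open>x \<in> T\<close> \<open>v \<noteq> 0\<close>] by metis
    have "(d + e) *\<^sub>R v \<noteq> 0" using de(1,2) \<open>v \<noteq> 0\<close> by simp
    then have "x + d *\<^sub>R v \<noteq> x - e *\<^sub>R v" by (auto simp: algebra_simps)
    then obtain p where "p \<in> frontier T" "p \<noteq> z" using de(3,4) by metis
    with swap[OF zf] z(2) show False by metis
  qed
  obtain b where b: "b > 0" "\<And>g x y. g \<in> affine_symmetries T \<Longrightarrow> dist (g x) (g y) \<le> b * dist x y"
    using affine_symmetries_lipschitz[OF T(1-3)] by metis
  \<comment> \<open>Linear parts are read off around the common fixed point \<open>z\<close>, so
    composition of symmetries becomes matrix multiplication.\<close>
  define \<L> where "\<L> = {L. (\<lambda>x. L *v (x - z) + z) \<in> affine_symmetries T}"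
  have linear_part: "\<exists>L\<in>\<L>. \<forall>x. g x = L *v (x - z) + z" if g: "g \<in> affine_symmetries T" for g
  proof -
    obtain l where l: "linear l" "\<And>x y. g x - g y = l (x - y)"
      using g affine_mapE unfolding affine_symmetries_def by blast
    have mv: "matrix l *v x = l x" for x
      by (rule matrix_works) (simp add: linear_matrix_vector_mul_eq l(1))
    have "g x = matrix l *v (x - z) + z" for x
      unfolding mv using l(2)[of x z, symmetric] z(2)[OF g] by simp
    moreover from this have "(\<lambda>x. matrix l *v (x - z) + z) = g" by auto
    then have "matrix l \<in> \<L>" using g by (simp add: \<L>_def)
    ultimately show ?thesis by blast
  qed
  obtain M where M: "transpose M = M" "\<And>x. x \<noteq> 0 \<Longrightarrow> x \<bullet> (M *v x) > 0"
    "\<And>L x. L \<in> \<L> \<Longrightarrow> (L *v x) \<bullet> (M *v (L *v x)) = x \<bullet> (M *v x)"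
  proof (rule invariant_form[of \<L> b])
    show "mat 1 \<in> \<L>" using id_affine_symmetries[of T] by (simp add: \<L>_def id_def)
    show "K ** L \<in> \<L>" if "K \<in> \<L>" "L \<in> \<L>" for K L
    proof -
      have "(\<lambda>x. K *v (x - z) + z) \<circ> (\<lambda>x. L *v (x - z) + z) \<in> affine_symmetries T"
        using that comp_affine_symmetries by (simp add: \<L>_def)
      then show ?thesis by (simp add: \<L>_def o_def matrix_vector_mul_assoc)
    qed
    show "\<exists>K\<in>\<L>. L ** K = mat 1" if "L \<in> \<L>" for L
    proof -
      define g where "g = (\<lambda>x. L *v (x - z) + z)"
      have g: "g \<in> affine_symmetries T" using that by (simp add: \<L>_def g_def)
      obtain K where K: "K \<in> \<L>" "\<And>x. inv g x = K *v (x - z) + z"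
        using linear_part[OF inv_affine_symmetries[OF g]] by blast
      have "surj g" using g by (simp add: affine_symmetries_def bij_is_surj)
      have "(L ** K) *v x = x" for x
        using surj_f_inv_f[OF \<open>surj g\<close>, of "x + z"] K(2)[of "x + z"]
        by (simp add: g_def matrix_vector_mul_assoc)
      then have "L ** K = mat 1" by (simp add: matrix_eq)
      then show ?thesis using K by blast
    qed
    show "norm (L *v x) \<le> b * norm x" if "L \<in> \<L>" for L x
      using b(2)[of "\<lambda>x. L *v (x - z) + z" "x + z" z] that by (simp add: \<L>_def dist_norm)
  qed (use b(1) in auto)
  define f where "f x = (x - z) \<bullet> (M *v (x - z))" for x
  have f_eq: "f p = f q" if pq: "p \<in> frontier T" "q \<in> frontier T" for p q
  proof (cases "p = q")
    case False
    obtain g where g: "g \<in> affine_symmetries T" "g p = q" using swap[OF pq False] by blast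
    obtain L where "L \<in> \<L>" "\<And>x. g x = L *v (x - z) + z" using linear_part[OF g(1)] by blast
    then have "L \<in> \<L>" "q - z = L *v (p - z)" using g(2) by auto
    then show ?thesis using M(3) by (simp add: f_def)
  qed simp
  have "z \<in> interior T" using \<open>z \<in> T\<close> T(1) by (simp add: interior_open)
  obtain v :: "real^'n" where "v \<noteq> 0" using vector_choose_size[of 1] by (metis norm_zero zero_neq_one zero_le_one)
  obtain p0 where p0: "p0 \<in> frontier T"
    using ray_to_frontier[OF T(2) \<open>z \<in> interior T\<close> \<open>v \<noteq> 0\<close>] by metis
  define k where "k = f p0"
  have "p0 \<noteq> z" using p0 \<open>z \<in> interior T\<close> by (auto simp: frontier_def)
  then have "k > 0" using M(2)[of "p0 - z"] by (simp add: k_def f_def)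
  have iff: "x \<in> frontier T \<longleftrightarrow> f x = k" for x
  proof
    assume "x \<in> frontier T"
    then show "f x = k" unfolding k_def using p0 by (rule f_eq)
  next
    assume fx: "f x = k"
    then have "x - z \<noteq> 0" using \<open>k > 0\<close> by (auto simp: f_def)
    then obtain d where d: "d > 0" "z + d *\<^sub>R (x - z) \<in> frontier T"
      using ray_to_frontier[OF T(2) \<open>z \<in> interior T\<close>] by metis
    \<comment> \<open>\<open>f\<close> is homogeneous of degree two about \<open>z\<close>.
      Comparing \<open>x\<close> with the frontier point on the ray from \<open>z\<close> through
      \<open>x\<close> forces \<open>d = 1\<close>.\<close>
    have "f (z + d *\<^sub>R (x - z)) = d\<^sup>2 * f x"
      by (simp add: f_def matrix_vector_mult_scaleR power2_eq_square)
    moreover have "f (z + d *\<^sub>R (x - z)) = k" unfolding k_def by (rule f_eq[OF d(2) p0])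
    ultimately have "d\<^sup>2 = 1" using fx \<open>k > 0\<close> by simp
    then have "d = 1" using d(1) by (simp add: power2_eq_1_iff)
    then show "x \<in> frontier T" using d(2) by simp
  qed
  define M' where "M' = (1 / k) *\<^sub>R M"
  have M'v: "x \<bullet> (M' *v x) = x \<bullet> (M *v x) / k" for x
    by (simp add: M'_def flip: scaleR_matrix_vector_assoc)
  have "transpose M' = M'" using M(1) by (simp add: M'_def transpose_def vec_eq_iff)
  moreover have "\<forall>x. x \<noteq> 0 \<longrightarrow> x \<bullet> (M' *v x) > 0" using M(2) \<open>k > 0\<close> by (simp add: M'v)
  moreover have "frontier T = {x. (x - z) \<bullet> (M' *v (x - z)) = 1}"
    using iff \<open>k > 0\<close> by (auto simp: M'v f_def)
  ultimately show ?thesis unfolding ellipsoid_def by blast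
qed

section \<open>Boundary geometry of smooth strictly convex bodies\<close>

text \<open>Serves both for the table \<open>K\<close> and for \<open>T\<close>. The order
  \<open>Suc k\<close> exposes one derivative of the local defining function, which yields the
  gradient.\<close>

locale smooth_convex_body =
  fixes D :: "'a::euclidean_space set" and k :: nat
  assumes open_D: "open D" and bounded_D: "bounded D" and D_nonempty: "D \<noteq> {}"
    and strict_D: "strictly_convex D" and smooth_D: "Ck_boundary (Suc k) D"
begin

lemma segment_subset:
  assumes "x \<in> closure D" "y \<in> closure D" "x \<noteq> y" "0 < t" "t < 1"
  shows "x + t *\<^sub>R (y - x) \<in> D"
proof -
  have "x + t *\<^sub>R (y - x) \<in> open_segment x y"
    using assms(3-5) by (auto simp: in_segment algebra_simps intro!: exI[of _ t])
  then show ?thesis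
    using strict_D assms(1-3) interior_subset unfolding strictly_convex_def by blast
qed

lemma convex_D: "convex D"
proof (rule convexI)
  fix x y :: 'a and u v :: real
  assume xy: "x \<in> D" "y \<in> D" and uv: "0 \<le> u" "0 \<le> v" "u + v = 1"
  have u: "u = 1 - v" using uv by simp
  have eq: "u *\<^sub>R x + v *\<^sub>R y = x + v *\<^sub>R (y - x)" unfolding u by (simp add: algebra_simps)
  consider "v = 0" | "v = 1" | "x = y" | "0 < v" "v < 1" "x \<noteq> y" using uv by linarith
  then show "u *\<^sub>R x + v *\<^sub>R y \<in> D"
  proof cases
    case 4
    then show ?thesis unfolding eq
      by (intro segment_subset) (use xy closure_subset in auto)
  qed (use xy eq in auto)
qed

lemma frontier_subset: "frontier D \<subseteq> closure D"
  by (simp add: frontier_def)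

lemma frontier_disjoint: "frontier D \<inter> D = {}"
  using open_D by (auto simp: frontier_def interior_open)

lemma defining_function:
  assumes "q \<in> frontier D"
  obtains f g U where "open U" "q \<in> U" "(f has_derivative (\<lambda>v. g \<bullet> v)) (at q)" "g \<noteq> 0"
    "D \<inter> U = {x\<in>U. f x < (0::real)}" "frontier D \<inter> U = {x\<in>U. f x = 0}"
proof -
  obtain U f where U: "open U" "q \<in> U" "Ck_on (Suc k) f U"
    "\<forall>x\<in>U. frechet_derivative f (at x) \<noteq> (\<lambda>v. 0)"
    "D \<inter> U = {x\<in>U. f x < 0}" "frontier D \<inter> U = {x\<in>U. f x = 0}"
    using smooth_D assms unfolding Ck_boundary_def by meson
  define F where "F = frechet_derivative f (at q)"
  have F: "(f has_derivative F) (at q)"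
    using U(2,3) by (simp add: F_def frechet_derivative_works)
  then have "linear F" by (rule has_derivative_linear)
  \<comment> \<open>The adjoint at 1 is the gradient: it represents the functional \<open>F\<close>
    as an inner product.\<close>
  define g where "g = adjoint F 1"
  have g: "F v = g \<bullet> v" for v
    using adjoint_works[OF \<open>linear F\<close>, of v 1] by (simp add: g_def inner_commute)
  then have Fg: "F = (\<lambda>v. g \<bullet> v)" by (rule ext)
  moreover have "F \<noteq> (\<lambda>v. 0)" using U(2,4) by (simp add: F_def)
  ultimately have "g \<noteq> 0" by auto
  then show ?thesis using that[of U f g] U(1,2,5,6) F unfolding Fg by blast
qed

text \<open>The defining function vanishes along curves in the frontier, so their velocities are
  orthogonal to its gradient. Along a straight line leaving \<open>q\<close>, the sign of its
  derivative decides the side. Later arguments use the gradient only through these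
  properties.\<close>

lemma boundary_gradient:
  assumes q: "q \<in> frontier D"
  obtains g where "g \<noteq> 0" "\<And>v. v \<in> tangent_space (frontier D) q \<Longrightarrow> g \<bullet> v = 0"
    "\<And>w. g \<bullet> w < 0 \<Longrightarrow> \<forall>\<^sub>F t in at_right 0. q + t *\<^sub>R w \<in> D"
    "\<And>w. g \<bullet> w > 0 \<Longrightarrow> \<forall>\<^sub>F t in at_right 0. q + t *\<^sub>R w \<notin> closure D"
proof -
  obtain f g U where f: "open U" "q \<in> U" "(f has_derivative (\<lambda>v. g \<bullet> v)) (at q)" "g \<noteq> 0"
    "D \<inter> U = {x\<in>U. f x < (0::real)}" "frontier D \<inter> U = {x\<in>U. f x = 0}"
    by (rule defining_function[OF q])
  have fq: "f q = 0" using f(2,6) q by blast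
  have cl: "closure D = D \<union> frontier D" using closure_Un_frontier by blast
  have chain: "((\<lambda>t. f (\<gamma> t)) has_real_derivative g \<bullet> v) (at 0)"
    if "(\<gamma> has_vector_derivative v) (at 0)" "\<gamma> 0 = q" for \<gamma> v
  proof -
    have "(\<gamma> has_derivative (\<lambda>t. t *\<^sub>R v)) (at 0)"
      using that(1) by (simp add: has_vector_derivative_def)
    moreover have "(f has_derivative (\<lambda>v. g \<bullet> v)) (at (\<gamma> 0))" using f(3) that(2) by simp
    ultimately have "(f \<circ> \<gamma> has_derivative (\<lambda>v. g \<bullet> v) \<circ> (\<lambda>t. t *\<^sub>R v)) (at 0)"
      by (rule diff_chain_at)
    moreover have "(\<lambda>v. g \<bullet> v) \<circ> (\<lambda>t. t *\<^sub>R v) = (*) (g \<bullet> v)" by (auto simp: fun_eq_iff)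
    ultimately show ?thesis by (simp add: has_field_derivative_def o_def)
  qed
  have inU: "\<forall>\<^sub>F t in nhds 0. \<gamma> t \<in> U"
    if "(\<gamma> has_vector_derivative v) (at 0)" "\<gamma> 0 = q" for \<gamma> :: "real \<Rightarrow> 'a" and v
  proof -
    have "isCont \<gamma> 0" using that(1) by (rule has_vector_derivative_continuous)
    then have "\<forall>\<^sub>F t in at 0. \<gamma> t \<in> U"
      using that(2) f(1,2) by (simp add: isCont_def topological_tendstoD)
    then show ?thesis using that(2) f(2) by (simp add: eventually_nhds_conv_at)
  qed
  have line: "((\<lambda>t. q + t *\<^sub>R w) has_vector_derivative w) (at 0)" for w
    by (auto intro!: derivative_eq_intros)
  have lineU: "\<forall>\<^sub>F t in at_right 0. q + t *\<^sub>R w \<in> U" for w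
    using inU[OF line[of w]] by (simp add: eventually_nhds_conv_at eventually_at_split)
  show ?thesis
  proof (rule that[of g])
    show "g \<bullet> v = 0" if v: "v \<in> tangent_space (frontier D) q" for v
    proof -
      obtain \<gamma> :: "real \<Rightarrow> 'a" where \<gamma>: "\<gamma> 0 = q" "\<forall>\<^sub>F t in nhds 0. \<gamma> t \<in> frontier D"
        "(\<gamma> has_vector_derivative v) (at 0)"
        using v unfolding tangent_space_def by blast
      have "\<forall>\<^sub>F t in nhds 0. f (\<gamma> t) = 0"
        using \<gamma>(2) inU[OF \<gamma>(3,1)] by eventually_elim (use f(6) in blast)
      then have "((\<lambda>t. f (\<gamma> t)) has_real_derivative 0) (at 0) \<longleftrightarrow> ((\<lambda>t. 0) has_real_derivative 0) (at (0::real))"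
        by (intro DERIV_cong_ev) auto
      then have "((\<lambda>t. f (\<gamma> t)) has_real_derivative 0) (at 0)" by simp
      then show ?thesis using chain[OF \<gamma>(3,1)] DERIV_unique by blast
    qed
    show "\<forall>\<^sub>F t in at_right 0. q + t *\<^sub>R w \<in> D" if w: "g \<bullet> w < 0" for w
    proof -
      obtain d where d: "d > 0" "\<And>h. 0 < h \<Longrightarrow> h < d \<Longrightarrow> f (q + (0 + h) *\<^sub>R w) < f (q + 0 *\<^sub>R w)"
        using DERIV_neg_dec_right[OF chain[OF line[of w]] w] by auto
      have "\<forall>\<^sub>F h in at_right (0::real). 0 < h \<and> h < d"
        using d(1) by (auto simp: eventually_at_right_field)
      then show ?thesis using lineU[of w]
      proof eventually_elim
        case (elim t)
        then show ?case using d(2)[of t] fq f(5) by auto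
      qed
    qed
    show "\<forall>\<^sub>F t in at_right 0. q + t *\<^sub>R w \<notin> closure D" if w: "g \<bullet> w > 0" for w
    proof -
      obtain d where d: "d > 0" "\<And>h. 0 < h \<Longrightarrow> h < d \<Longrightarrow> f (q + (0 + h) *\<^sub>R w) > f (q + 0 *\<^sub>R w)"
        using DERIV_pos_inc_right[OF chain[OF line[of w]] w] by auto
      have "\<forall>\<^sub>F h in at_right (0::real). 0 < h \<and> h < d"
        using d(1) by (auto simp: eventually_at_right_field)
      then show ?thesis using lineU[of w]
      proof eventually_elim
        case (elim t)
        then have "f (q + t *\<^sub>R w) > 0" using d(2)[of t] fq by auto
        then have "q + t *\<^sub>R w \<notin> D \<inter> U" "q + t *\<^sub>R w \<notin> frontier D \<inter> U"
          unfolding f(5,6) by auto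
        then show ?case using elim(2) by (simp add: cl)
      qed
    qed
  qed (rule f(4))
qed

text \<open>A curve in the boundary with prescribed velocity: move along the tangent line and
  correct by the smallest multiple of the gradient that reaches the boundary.  Points shifted
  by \<open>\<plusminus>\<epsilon>t\<close> lie on different sides of the boundary, so the correction is \<open>o(t)\<close>.\<close>

lemma tangent_space_superset:
  assumes q: "q \<in> frontier D"
    and inside: "\<And>w. g \<bullet> w < 0 \<Longrightarrow> \<forall>\<^sub>F t in at_right 0. q + t *\<^sub>R w \<in> D"
    and outside: "\<And>w. g \<bullet> w > 0 \<Longrightarrow> \<forall>\<^sub>F t in at_right 0. q + t *\<^sub>R w \<notin> closure D"
    and "g \<noteq> 0" and v: "g \<bullet> v = 0"
  shows "v \<in> tangent_space (frontier D) q"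
proof -
  have "g \<bullet> g > 0" using \<open>g \<noteq> 0\<close> by simp
  have right: "\<forall>\<^sub>F t in at_right 0. \<exists>s. \<bar>s\<bar> \<le> \<epsilon> * t \<and> q + t *\<^sub>R w + s *\<^sub>R g \<in> frontier D"
    if "\<epsilon> > 0" "g \<bullet> w = 0" for \<epsilon> w
  proof -
    have "\<forall>\<^sub>F t in at_right 0. q + t *\<^sub>R (w - \<epsilon> *\<^sub>R g) \<in> D"
      by (rule inside) (use that \<open>g \<bullet> g > 0\<close> in \<open>simp add: inner_diff_right\<close>)
    moreover have "\<forall>\<^sub>F t in at_right 0. q + t *\<^sub>R (w + \<epsilon> *\<^sub>R g) \<notin> closure D"
      by (rule outside) (use that \<open>g \<bullet> g > 0\<close> in \<open>simp add: inner_add_right\<close>)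
    moreover have "\<forall>\<^sub>F t in at_right (0::real). t > 0" by (simp add: eventually_at_right_less)
    ultimately show ?thesis
    proof eventually_elim
      case (elim t)
      \<comment> \<open>A short segment along \<open>g\<close> from a point of \<open>D\<close> to a
        point outside; being connected, it crosses the frontier.\<close>
      define S where "S = (\<lambda>s. q + t *\<^sub>R w + s *\<^sub>R g) ` {- (\<epsilon> * t)..\<epsilon> * t}"
      have "connected S" unfolding S_def
        by (intro connected_continuous_image continuous_intros) simp
      moreover have "q + t *\<^sub>R (w - \<epsilon> *\<^sub>R g) \<in> S"
        unfolding S_def using elim(3) \<open>\<epsilon> > 0\<close>
        by (intro image_eqI[of _ _ "- (\<epsilon> * t)"]) (auto simp: algebra_simps)
      moreover have "q + t *\<^sub>R (w + \<epsilon> *\<^sub>R g) \<in> S"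
        unfolding S_def using elim(3) \<open>\<epsilon> > 0\<close>
        by (intro image_eqI[of _ _ "\<epsilon> * t"]) (auto simp: algebra_simps)
      moreover have "q + t *\<^sub>R (w + \<epsilon> *\<^sub>R g) \<notin> D" using elim(2) closure_subset by blast
      ultimately have "S \<inter> frontier D \<noteq> {}" using elim(1) by (intro connected_Int_frontier) blast+
      then obtain s where s: "s \<in> {- (\<epsilon> * t)..\<epsilon> * t}" "q + t *\<^sub>R w + s *\<^sub>R g \<in> frontier D"
        unfolding S_def by blast
      then have "\<bar>s\<bar> \<le> \<epsilon> * t" by auto
      then show ?case using s(2) by blast
    qed
  qed
  have both: "\<forall>\<^sub>F t in at 0. \<exists>s. \<bar>s\<bar> \<le> \<epsilon> * \<bar>t\<bar> \<and> q + t *\<^sub>R v + s *\<^sub>R g \<in> frontier D"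
    if "\<epsilon> > 0" for \<epsilon>
    unfolding eventually_at_split
  proof
    have pos: "\<forall>\<^sub>F t in at_right (0::real). t > 0" by (simp add: eventually_at_right_less)
    show "\<forall>\<^sub>F t in at_right 0. \<exists>s. \<bar>s\<bar> \<le> \<epsilon> * \<bar>t\<bar> \<and> q + t *\<^sub>R v + s *\<^sub>R g \<in> frontier D"
      using right[OF that v] pos by eventually_elim simp
    \<comment> \<open>Negative times reduce to positive ones by running the tangent line backwards,
      with velocity \<open>- v\<close>.\<close>
    have "\<forall>\<^sub>F t in at_right 0. \<exists>s. \<bar>s\<bar> \<le> \<epsilon> * t \<and> q + t *\<^sub>R (- v) + s *\<^sub>R g \<in> frontier D"
      by (rule right[OF that]) (simp add: v)
    then have "\<forall>\<^sub>F t in at_right 0. \<exists>s. \<bar>s\<bar> \<le> \<epsilon> * \<bar>- t\<bar> \<and> q + (- t) *\<^sub>R v + s *\<^sub>R g \<in> frontier D"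
      using pos by eventually_elim simp
    then show "\<forall>\<^sub>F t in at_left 0. \<exists>s. \<bar>s\<bar> \<le> \<epsilon> * \<bar>t\<bar> \<and> q + t *\<^sub>R v + s *\<^sub>R g \<in> frontier D"
      unfolding at_left_minus[of 0] eventually_filtermap by simp
  qed
  \<comment> \<open>The least correction is bounded by every other one, so the single function
    \<open>\<sigma>\<close> satisfies the estimate for all \<open>\<epsilon>\<close>, although the
    corrections found above depend on \<open>\<epsilon>\<close>.\<close>
  define Z where "Z t = {s. q + t *\<^sub>R v + s *\<^sub>R g \<in> frontier D}" for t
  have "\<exists>s. Z t \<noteq> {} \<longrightarrow> s \<in> Z t \<and> (\<forall>r\<in>Z t. \<bar>s\<bar> \<le> \<bar>r\<bar>)" for t
  proof (cases "Z t = {}")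
    case False
    have "Z t = (\<lambda>s. q + t *\<^sub>R v + s *\<^sub>R g) -` frontier D" by (auto simp: Z_def)
    moreover have "closed ((\<lambda>s. q + t *\<^sub>R v + s *\<^sub>R g) -` frontier D)"
      by (intro closed_vimage frontier_closed continuous_intros)
    ultimately obtain s where "s \<in> Z t" "\<And>r. r \<in> Z t \<Longrightarrow> dist 0 s \<le> dist 0 r"
      using distance_attains_inf[of "Z t" 0] False by metis
    then show ?thesis by auto
  qed simp
  then have "\<exists>\<sigma>. \<forall>t. Z t \<noteq> {} \<longrightarrow> \<sigma> t \<in> Z t \<and> (\<forall>r\<in>Z t. \<bar>\<sigma> t\<bar> \<le> \<bar>r\<bar>)"
    by (intro choice allI)
  then obtain \<sigma> where \<sigma>: "\<And>t. Z t \<noteq> {} \<Longrightarrow> \<sigma> t \<in> Z t" "\<And>t r. r \<in> Z t \<Longrightarrow> \<bar>\<sigma> t\<bar> \<le> \<bar>r\<bar>"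
    by blast
  have "0 \<in> Z 0" using q by (simp add: Z_def)
  then have "\<sigma> 0 = 0" using \<sigma>(2) by fastforce
  have small: "\<forall>\<^sub>F t in at 0. \<bar>\<sigma> t\<bar> \<le> \<epsilon> * \<bar>t\<bar>" if "\<epsilon> > 0" for \<epsilon>
    using both[OF that]
  proof eventually_elim
    case (elim t)
    then obtain s where s: "\<bar>s\<bar> \<le> \<epsilon> * \<bar>t\<bar>" "s \<in> Z t" by (auto simp: Z_def)
    then show ?case using \<sigma>(2)[OF s(2)] by linarith
  qed
  have "(\<sigma> has_real_derivative 0) (at 0)"
    unfolding has_field_derivative_iff
  proof (rule tendstoI)
    fix e :: real assume "e > 0"
    have "\<forall>\<^sub>F t in at (0::real). t \<noteq> 0" by (simp add: eventually_at_filter)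
    moreover have "\<forall>\<^sub>F t in at 0. \<bar>\<sigma> t\<bar> \<le> e / 2 * \<bar>t\<bar>" by (rule small) (use \<open>e > 0\<close> in simp)
    ultimately show "\<forall>\<^sub>F t in at 0. dist ((\<sigma> t - \<sigma> 0) / (t - 0)) 0 < e"
    proof eventually_elim
      case (elim t)
      then have "\<bar>\<sigma> t\<bar> / \<bar>t\<bar> \<le> e / 2" by (simp add: pos_divide_le_eq)
      also have "\<dots> < e" using \<open>e > 0\<close> by simp
      finally show ?case by (simp add: dist_real_def abs_divide \<open>\<sigma> 0 = 0\<close>)
    qed
  qed
  then have "((\<lambda>t. q + t *\<^sub>R v + \<sigma> t *\<^sub>R g) has_vector_derivative v) (at 0)"
    by (auto intro!: derivative_eq_intros)
  moreover have "\<forall>\<^sub>F t in nhds 0. q + t *\<^sub>R v + \<sigma> t *\<^sub>R g \<in> frontier D"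
  proof -
    have "\<forall>\<^sub>F t in at 0. q + t *\<^sub>R v + \<sigma> t *\<^sub>R g \<in> frontier D"
      using both[OF zero_less_one]
    proof eventually_elim
      case (elim t)
      then have "Z t \<noteq> {}" by (auto simp: Z_def)
      then show ?case using \<sigma>(1)[of t] by (simp add: Z_def)
    qed
    moreover have "q + 0 *\<^sub>R v + \<sigma> 0 *\<^sub>R g \<in> frontier D" using q \<open>\<sigma> 0 = 0\<close> by simp
    ultimately show ?thesis unfolding eventually_nhds_conv_at by blast
  qed
  ultimately show ?thesis
    unfolding tangent_space_def using \<open>\<sigma> 0 = 0\<close>
    by (intro CollectI exI[of _ "\<lambda>t. q + t *\<^sub>R v + \<sigma> t *\<^sub>R g"]) simp
qed

text \<open>The normalised gradient is the only vector meeting the definite description: a unit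
  vector orthogonal to the tangent hyperplane is plus or minus it, and the minus sign points into
  \<open>D\<close>.\<close>

lemma exterior_normal_properties:
  assumes q: "q \<in> frontier D"
  shows norm_normal: "norm (exterior_normal D q) = 1"
    and tangent_space_normal: "tangent_space (frontier D) q = {v. exterior_normal D q \<bullet> v = 0}"
    and inside: "\<And>w. exterior_normal D q \<bullet> w < 0 \<Longrightarrow> \<forall>\<^sub>F t in at_right 0. q + t *\<^sub>R w \<in> D"
    and outside: "\<And>w. exterior_normal D q \<bullet> w > 0 \<Longrightarrow> \<forall>\<^sub>F t in at_right 0. q + t *\<^sub>R w \<notin> closure D"
proof -
  obtain g where g: "g \<noteq> 0" "\<And>v. v \<in> tangent_space (frontier D) q \<Longrightarrow> g \<bullet> v = 0"
    "\<And>w. g \<bullet> w < 0 \<Longrightarrow> \<forall>\<^sub>F t in at_right 0. q + t *\<^sub>R w \<in> D"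
    "\<And>w. g \<bullet> w > 0 \<Longrightarrow> \<forall>\<^sub>F t in at_right 0. q + t *\<^sub>R w \<notin> closure D"
    by (rule boundary_gradient[OF q], rule that) blast+
  have ts: "tangent_space (frontier D) q = {v. g \<bullet> v = 0}"
    using g(2) tangent_space_superset[OF q g(3,4,1)] by blast
  define n where "n = sgn g"
  have n: "norm n = 1" using g(1) by (simp add: n_def norm_sgn)
  have gn: "g = norm g *\<^sub>R n" using g(1) by (simp add: n_def sgn_div_norm)
  have sgns: "g \<bullet> w = norm g * (n \<bullet> w)" for w by (subst gn) simp
  have gpos: "norm g > 0" using g(1) by simp
  have "exterior_normal D q = n"
    unfolding exterior_normal_def
  proof (rule the_equality, intro conjI)
    show "norm n = 1" by (rule n)
    show "\<forall>v\<in>tangent_space (frontier D) q. n \<bullet> v = 0"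
      using gpos by (simp add: ts sgns)
    show "\<forall>\<^sub>F t in at_right 0. q + t *\<^sub>R n \<notin> closure D"
      by (rule g(4)) (use gpos n in \<open>simp add: sgns dot_square_norm\<close>)
  next
    fix \<nu>
    assume "norm \<nu> = 1 \<and> (\<forall>v\<in>tangent_space (frontier D) q. \<nu> \<bullet> v = 0) \<and>
      (\<forall>\<^sub>F t in at_right 0. q + t *\<^sub>R \<nu> \<notin> closure D)"
    then have \<nu>: "norm \<nu> = 1" "\<And>v. n \<bullet> v = 0 \<Longrightarrow> \<nu> \<bullet> v = 0"
      "\<forall>\<^sub>F t in at_right 0. q + t *\<^sub>R \<nu> \<notin> closure D"
      by (auto simp: ts sgns)
    define a where "a = \<nu> \<bullet> n"
    define v where "v = \<nu> - a *\<^sub>R n"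
    have nn: "n \<bullet> n = 1" using n by (simp add: dot_square_norm)
    have nv: "n \<bullet> v = 0" by (simp add: v_def inner_diff_right nn a_def inner_commute)
    have "v \<bullet> v = \<nu> \<bullet> v - a * (n \<bullet> v)" by (simp add: v_def inner_diff_left)
    then have "v = 0" using \<nu>(2)[OF nv] nv by simp
    then have \<nu>a: "\<nu> = a *\<^sub>R n" by (simp add: v_def)
    then have "\<bar>a\<bar> = 1" using \<nu>(1) n by simp
    moreover have "a \<noteq> -1"
    proof
      assume "a = -1"
      then have "g \<bullet> \<nu> < 0" using \<nu>a nn gpos by (simp add: sgns)
      then have "\<forall>\<^sub>F t in at_right 0. q + t *\<^sub>R \<nu> \<in> D" by (rule g(3))
      with \<nu>(3) have "\<forall>\<^sub>F t in at_right (0::real). False"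
        by eventually_elim (use closure_subset in blast)
      then show False by simp
    qed
    ultimately have "a = 1" by linarith
    then show "\<nu> = n" using \<nu>a by simp
  qed
  then show "norm (exterior_normal D q) = 1"
    "tangent_space (frontier D) q = {v. exterior_normal D q \<bullet> v = 0}"
    "\<And>w. exterior_normal D q \<bullet> w < 0 \<Longrightarrow> \<forall>\<^sub>F t in at_right 0. q + t *\<^sub>R w \<in> D"
    "\<And>w. exterior_normal D q \<bullet> w > 0 \<Longrightarrow> \<forall>\<^sub>F t in at_right 0. q + t *\<^sub>R w \<notin> closure D"
    using n ts g(3,4) gpos by (auto simp: sgns mult_pos_neg)
qed

text \<open>For a point \<open>x\<close> of the closure beyond the tangent hyperplane, the segment
  from \<open>q\<close> to \<open>x\<close> would start outside the closure by
  \<open>outside\<close>, yet lie in \<open>D\<close> by strict convexity.\<close>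

lemma normal_supports:
  assumes q: "q \<in> frontier D" and x: "x \<in> closure D"
  shows "exterior_normal D q \<bullet> x \<le> exterior_normal D q \<bullet> q"
proof (rule ccontr)
  assume gt: "\<not> ?thesis"
  then have "exterior_normal D q \<bullet> (x - q) > 0" by (simp add: inner_diff_right)
  then have "\<forall>\<^sub>F t in at_right 0. q + t *\<^sub>R (x - q) \<notin> closure D" by (rule outside[OF q])
  moreover have "\<forall>\<^sub>F t in at_right (0::real). t \<in> {0<..<1}"
    by (rule eventually_at_right_real) simp
  ultimately have "\<forall>\<^sub>F t in at_right (0::real). False"
  proof eventually_elim
    case (elim t)
    have "q \<noteq> x" using gt by auto
    moreover have "q \<in> closure D" using q frontier_subset by blast
    ultimately have "q + t *\<^sub>R (x - q) \<in> D" using segment_subset x elim by simp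
    then show ?case using elim closure_subset by blast
  qed
  then show False by simp
qed

text \<open>The midpoint of \<open>q\<close> and \<open>x\<close> lies in the open set
  \<open>D\<close>, so it can be pushed a little along the normal and still obey the weak
  inequality. This leaves a gap.\<close>

lemma normal_supports_strictly:
  assumes q: "q \<in> frontier D" and x: "x \<in> closure D" and "x \<noteq> q"
  shows "exterior_normal D q \<bullet> x < exterior_normal D q \<bullet> q"
proof -
  let ?n = "exterior_normal D q"
  have "q \<in> closure D" using q frontier_subset by blast
  then have m: "q + (1/2) *\<^sub>R (x - q) \<in> D" (is "?m \<in> D") using segment_subset x \<open>x \<noteq> q\<close> by simp
  then obtain e where e: "e > 0" "ball ?m e \<subseteq> D" using open_D open_contains_ball by blast
  have "?m + (e / 2) *\<^sub>R ?n \<in> ball ?m e" using e(1) norm_normal[OF q] by (simp add: dist_norm)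
  then have "?m + (e / 2) *\<^sub>R ?n \<in> closure D" using e(2) closure_subset by blast
  then have "?n \<bullet> (?m + (e / 2) *\<^sub>R ?n) \<le> ?n \<bullet> q" by (rule normal_supports[OF q])
  moreover have "?n \<bullet> ?n = 1" using norm_normal[OF q] by (simp add: dot_square_norm)
  ultimately have "(?n \<bullet> x - ?n \<bullet> q) / 2 + e / 2 \<le> 0"
    by (simp add: inner_add_right inner_diff_right)
  then have "(?n \<bullet> x - ?n \<bullet> q) + e \<le> 0" by (simp flip: add_divide_distrib)
  then show ?thesis using e(1) by linarith
qed

lemma normal_inj:
  assumes "p \<in> frontier D" "q \<in> frontier D" "exterior_normal D p = exterior_normal D q"
  shows "p = q"
proof (rule ccontr)
  assume "p \<noteq> q"
  moreover have "p \<in> closure D" "q \<in> closure D" using assms frontier_subset by auto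
  ultimately show False
    using normal_supports_strictly[OF assms(1), of q] normal_supports_strictly[OF assms(2), of p] assms(3)
    by simp
qed

text \<open>If \<open>u\<close> differed from the normal \<open>n\<close>, the direction
  \<open>u - n\<close> would point into \<open>D\<close>, while \<open>u\<close> increases along
  it.\<close>

lemma normal_unique:
  assumes q: "q \<in> frontier D" and "norm u = 1" and "\<And>x. x \<in> D \<Longrightarrow> u \<bullet> x \<le> u \<bullet> q"
  shows "exterior_normal D q = u"
proof (rule ccontr)
  let ?n = "exterior_normal D q"
  assume ne: "?n \<noteq> u"
  have nn: "?n \<bullet> ?n = 1" "u \<bullet> u = 1" using norm_normal[OF q] assms(2) by (auto simp: dot_square_norm)
  have "(?n - u) \<bullet> (?n - u) > 0" using ne by simp
  then have lt: "?n \<bullet> u < 1" using nn by (simp add: inner_diff_left inner_diff_right inner_commute)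
  have "\<forall>\<^sub>F t in at_right 0. q + t *\<^sub>R (u - ?n) \<in> D"
    by (rule inside[OF q]) (use lt nn in \<open>simp add: inner_diff_right\<close>)
  moreover have "\<forall>\<^sub>F t in at_right (0::real). t > 0" by (simp add: eventually_at_right_less)
  ultimately have "\<forall>\<^sub>F t in at_right (0::real). False"
  proof eventually_elim
    case (elim t)
    have "t * (1 - ?n \<bullet> u) \<le> 0"
      using assms(3)[OF elim(1)] nn by (simp add: inner_add_right inner_diff_right inner_commute)
    moreover have "t * (1 - ?n \<bullet> u) > 0" using elim(2) lt by simp
    ultimately show ?case by linarith
  qed
  then show False by simp
qed

text \<open>A maximiser of the linear functional \<open>sgn u\<close> over the closure is a frontier
  point, and \<open>normal_unique\<close> identifies its normal.\<close>

lemma Gauss_map_surj: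
  assumes "u \<noteq> 0"
  shows "\<exists>p\<in>frontier D. exterior_normal D p = sgn u"
proof -
  have "compact (closure D)" using bounded_D by (simp add: compact_closure)
  moreover have "closure D \<noteq> {}" using D_nonempty by simp
  moreover have "continuous_on (closure D) (\<lambda>x. sgn u \<bullet> x)" by (intro continuous_intros)
  ultimately obtain p where p: "p \<in> closure D" "\<And>x. x \<in> closure D \<Longrightarrow> sgn u \<bullet> x \<le> sgn u \<bullet> p"
    using continuous_attains_sup[of "closure D"] by metis
  have nu: "norm (sgn u) = 1" using assms by (simp add: norm_sgn)
  have "p \<notin> D"
  proof
    assume "p \<in> D"
    then obtain e where e: "e > 0" "ball p e \<subseteq> D" using open_D open_contains_ball by blast
    have "p + (e / 2) *\<^sub>R sgn u \<in> ball p e" using e(1) nu by (simp add: dist_norm)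
    then have "p + (e / 2) *\<^sub>R sgn u \<in> closure D" using e(2) closure_subset by blast
    from p(2)[OF this] nu e(1) show False by (simp add: inner_add_right dot_square_norm)
  qed
  then have "p \<in> frontier D" using p(1) open_D by (simp add: frontier_def interior_open)
  moreover from this have "exterior_normal D p = sgn u"
    by (rule normal_unique) (use nu p(2) closure_subset in auto)
  ultimately show ?thesis by blast
qed

text \<open>The ray enters \<open>D\<close> at once by \<open>inside\<close>, and it must leave
  again because \<open>D\<close> is bounded.\<close>

lemma second_intersection:
  assumes p: "p \<in> frontier D" and w: "exterior_normal D p \<bullet> w < 0"
  shows "\<exists>t>0. p + t *\<^sub>R w \<in> frontier D"
proof -
  have "\<forall>\<^sub>F t in at_right (0::real). t > 0" by (simp add: eventually_at_right_less)
  with inside[OF p w] have "\<forall>\<^sub>F t in at_right 0. p + t *\<^sub>R w \<in> D \<and> t > 0"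
    by eventually_elim simp
  then obtain s where s: "p + s *\<^sub>R w \<in> D" "s > 0"
    using eventually_happens[of _ "at_right (0::real)"] by fastforce
  have "w \<noteq> 0" using w by auto
  moreover have "p + s *\<^sub>R w \<in> interior D" using s open_D by (simp add: interior_open)
  ultimately obtain d where "d > 0" "p + s *\<^sub>R w + d *\<^sub>R w \<in> frontier D"
    using ray_to_frontier[OF bounded_D] by metis
  then show ?thesis using s(2) by (intro exI[of _ "s + d"]) (simp add: scaleR_add_left add.assoc)
qed

lemma second_intersection_unique:
  assumes "p \<in> frontier D" "w \<noteq> 0" "s > 0" "t > 0"
    and "p + s *\<^sub>R w \<in> frontier D" "p + t *\<^sub>R w \<in> frontier D"
  shows "s = t"
proof -
  have *: False if "0 < s" "s < t" "p + s *\<^sub>R w \<in> frontier D" "p + t *\<^sub>R w \<in> frontier D" for s t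
  proof -
    have "p + (s / t) *\<^sub>R ((p + t *\<^sub>R w) - p) \<in> D"
      by (rule segment_subset) (use that assms(1,2) frontier_subset in auto)
    then have "p + s *\<^sub>R w \<in> D" using that by simp
    then show False using that(3) frontier_disjoint by blast
  qed
  then show ?thesis using assms by (metis linorder_neqE_linordered_idom)
qed

text \<open>Resolves the two definite descriptions in the reflection law: injectivity of the Gauss
  map determines \<open>p0\<close>, and uniqueness of the second intersection determines
  \<open>p1\<close>.\<close>

lemma T_billiard_reflection_chord:
  assumes p: "p0 \<in> frontier D" "p1 \<in> frontier D" and "t > 0" "p0 - p1 = t *\<^sub>R exterior_normal K q"
    "exterior_normal K q \<noteq> 0"
  shows "T_billiard_reflection D K q (oline_through q (exterior_normal D p0)) =
           oline_through q (exterior_normal D p1)"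
proof -
  let ?\<nu> = "exterior_normal K q"
  define n0 where "n0 = exterior_normal D p0"
  have snd: "snd (oline_through q n0) = n0"
    using norm_normal[OF p(1)] by (simp add: oline_through_def n0_def sgn_div_norm)
  have 0: "(THE p. p \<in> frontier D \<and> exterior_normal D p = n0) = p0"
    unfolding n0_def by (rule the_equality) (use p normal_inj in auto)
  have p1: "p1 = p0 + t *\<^sub>R (- ?\<nu>)" using assms(4) by (simp add: algebra_simps)
  have 1: "(THE p. p \<in> frontier D \<and> p \<noteq> p0 \<and> (\<exists>t\<ge>0. p = p0 + t *\<^sub>R (- ?\<nu>))) = p1"
  proof (rule the_equality)
    have "p1 \<noteq> p0" using assms(3,4) assms(5) by auto
    then show "p1 \<in> frontier D \<and> p1 \<noteq> p0 \<and> (\<exists>t\<ge>0. p1 = p0 + t *\<^sub>R (- ?\<nu>))"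
      using p p1 assms(3) less_imp_le by blast
  next
    fix p assume "p \<in> frontier D \<and> p \<noteq> p0 \<and> (\<exists>t\<ge>0. p = p0 + t *\<^sub>R (- ?\<nu>))"
    then obtain s where s: "p \<in> frontier D" "p \<noteq> p0" "s \<ge> 0" "p = p0 + s *\<^sub>R (- ?\<nu>)" by blast
    then have "s > 0" by (cases "s = 0") auto
    have "s = t"
      by (rule second_intersection_unique[OF p(1), of "- ?\<nu>"])
         (use assms(5) \<open>s > 0\<close> assms(3) s p(2) p1 in \<open>simp_all only: neg_equal_0_iff_equal not_False_eq_True\<close>)
    then show "p = p1" using s p1 by simp
  qed
  show ?thesis
    unfolding T_billiard_reflection_def n0_def[symmetric] snd 0 Let_def 1 ..
qed

end

section \<open>Projective reflections and midpoints of parallel chords\<close>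

lemma projective_involution_linear_part:
  fixes C :: "'a::euclidean_space set"
  assumes ts: "tangent_space C q = {v. \<nu> \<bullet> v = 0}" and Nq: "\<N> q = line_through q v" and v: "v \<notin> tangent_space C q"
  obtains N where "N \<bullet> \<nu> = 1"
    "\<And>u. projective_involution C \<N> q u - projective_involution C \<N> q 0 = u - (2 * (u \<bullet> \<nu>)) *\<^sub>R N"
proof -
  have nv: "\<nu> \<bullet> v \<noteq> 0" using v by (simp add: ts)
  \<comment> \<open>The generator of the transversal line normalised by
    \<open>N \<bullet> \<nu> = 1\<close>; transversality makes the division legitimate. The
    involution can then be written down explicitly as \<open>A\<close>.\<close>
  define N where "N = (1 / (\<nu> \<bullet> v)) *\<^sub>R v"
  have N: "N \<bullet> \<nu> = 1" using nv by (simp add: N_def inner_commute)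
  have vN: "v = (\<nu> \<bullet> v) *\<^sub>R N" using nv by (simp add: N_def)
  define A where "A x = x - (2 * ((x - q) \<bullet> \<nu>)) *\<^sub>R N" for x
  have Aline: "A (q + t *\<^sub>R v) = q - t *\<^sub>R v" for t
  proof -
    have "A (q + t *\<^sub>R v) = q + t *\<^sub>R v - (2 * t) *\<^sub>R ((\<nu> \<bullet> v) *\<^sub>R N)"
      by (simp add: A_def inner_commute)
    also have "\<dots> = q + t *\<^sub>R v - (t *\<^sub>R v + t *\<^sub>R v)"
      by (simp only: vN[symmetric] mult_2 scaleR_add_left)
    finally show ?thesis by simp
  qed
  have "projective_involution C \<N> q = A"
    unfolding projective_involution_def
  proof (rule the_equality, intro conjI)
    have "linear (\<lambda>x. x - (2 * (x \<bullet> \<nu>)) *\<^sub>R N)"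
      by (rule linearI) (auto simp: inner_add_left algebra_simps)
    moreover have "A = (\<lambda>x. (\<lambda>x. x - (2 * (x \<bullet> \<nu>)) *\<^sub>R N) x + (2 * (q \<bullet> \<nu>)) *\<^sub>R N)"
      by (auto simp: A_def inner_diff_left algebra_simps)
    ultimately show "affine_map A" unfolding affine_map_def by blast
    show "A \<circ> A = id"
      using N by (auto simp: fun_eq_iff A_def inner_diff_left algebra_simps)
    show "\<forall>v\<in>tangent_space C q. A (q + v) = q + v"
      by (simp add: ts A_def inner_commute)
    show "A ` \<N> q = \<N> q"
    proof
      show "A ` \<N> q \<subseteq> \<N> q"
        unfolding Nq line_through_def by (auto simp: Aline intro: exI[of _ "- t" for t])
      show "\<N> q \<subseteq> A ` \<N> q"
      proof
        fix x assume "x \<in> \<N> q"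
        then obtain t where "x = q + t *\<^sub>R v" unfolding Nq line_through_def by blast
        then have "x = A (q + (- t) *\<^sub>R v)" unfolding Aline by simp
        then show "x \<in> A ` \<N> q" unfolding Nq line_through_def by blast
      qed
    qed
    show "\<forall>x\<in>\<N> q. A x - q = - (x - q)"
      unfolding Nq line_through_def by (auto simp: Aline)
  next
    fix B assume "affine_map B \<and> B \<circ> B = id \<and> (\<forall>v\<in>tangent_space C q. B (q + v) = q + v) \<and>
      B ` \<N> q = \<N> q \<and> (\<forall>x\<in>\<N> q. B x - q = - (x - q))"
    then have B: "affine_map B" "\<And>w. \<nu> \<bullet> w = 0 \<Longrightarrow> B (q + w) = q + w" "\<And>x. x \<in> \<N> q \<Longrightarrow> B x - q = - (x - q)"
      by (auto simp: ts)
    obtain l where l: "linear l" "\<And>x y. B x - B y = l (x - y)"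
      using affine_mapE[OF B(1)] by blast
    have Bq: "B q = q" using B(2)[of 0] by simp
    have lw: "l w = w" if "\<nu> \<bullet> w = 0" for w
      using l(2)[of "q + w" q] B(2)[OF that] Bq by simp
    have "q + 1 *\<^sub>R v \<in> \<N> q" unfolding Nq line_through_def by blast
    then have "B (q + v) - q = - v" using B(3)[of "q + v"] by simp
    then have "l v = - v" using l(2)[of "q + v" q] Bq by simp
    then have lN: "l N = - N" by (simp add: N_def linear_cmul[OF l(1)])
    have "B x = A x" for x
    proof -
      \<comment> \<open>Splitting \<open>x - q\<close> into a tangent part and a multiple of
        \<open>N\<close>: an affine map fixing \<open>q\<close> is determined by its linear part on
        these two.\<close>
      define s where "s = (x - q) \<bullet> \<nu>"
      define w where "w = x - q - s *\<^sub>R N"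
      have "\<nu> \<bullet> w = 0" using N by (simp add: w_def s_def inner_diff_right inner_commute)
      have xq: "x - q = w + s *\<^sub>R N" by (simp add: w_def)
      have "B x - q = l (x - q)" using l(2)[of x q] Bq by simp
      also have "\<dots> = w - s *\<^sub>R N"
        unfolding xq by (simp add: linear_add[OF l(1)] linear_cmul[OF l(1)] lN lw \<open>\<nu> \<bullet> w = 0\<close>)
      also have "\<dots> = A x - q"
        unfolding A_def s_def[symmetric] w_def by (simp only: mult_2 scaleR_add_left) simp
      finally show ?thesis by simp
    qed
    then show "B = A" by (rule ext)
  qed
  moreover have "A u - A 0 = u - (2 * (u \<bullet> \<nu>)) *\<^sub>R N" for u
    by (simp add: A_def inner_diff_left algebra_simps)
  ultimately show ?thesis using that[of N] N by simp
qed

text \<open>Cutting the segment into \<open>m\<close> equal steps makes the inner products telescope and improves the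
  bound by the factor \<open>1/m\<close>.\<close>

lemma constant_if_abs_diff_le_inner:
  fixes F :: "'a::real_inner \<Rightarrow> 'a" and \<phi> :: "'a \<Rightarrow> real"
  assumes "convex X" and ineq: "\<And>x y. x \<in> X \<Longrightarrow> y \<in> X \<Longrightarrow> \<bar>\<phi> x - \<phi> y\<bar> \<le> (x - y) \<bullet> (F x - F y)"
    and x: "x \<in> X" and y: "y \<in> X"
  shows "\<phi> x = \<phi> y"
proof (rule ccontr)
  assume ne: "\<phi> x \<noteq> \<phi> y"
  define h where "h = y - x"
  have bound: "real m * \<bar>\<phi> y - \<phi> x\<bar> \<le> h \<bullet> (F y - F x)" if m: "m > 0" for m :: nat
  proof -
    define z where "z i = x + (real i / real m) *\<^sub>R h" for i :: nat
    have zX: "z i \<in> X" if "i \<le> m" for i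
    proof -
      have "z i = (1 - real i / real m) *\<^sub>R x + (real i / real m) *\<^sub>R y"
        by (simp add: z_def h_def algebra_simps)
      then show ?thesis using convexD_alt[OF assms(1) x y, of "real i / real m"] that m by simp
    qed
    have "i \<le> m \<Longrightarrow> real m * \<bar>\<phi> (z i) - \<phi> x\<bar> \<le> h \<bullet> (F (z i) - F x)" for i
    proof (induction i)
      case 0
      then show ?case by (simp add: z_def)
    next
      case (Suc i)
      have "z (Suc i) - z i = (1 / real m) *\<^sub>R h"
        by (simp add: z_def add_divide_distrib scaleR_add_left)
      then have "\<bar>\<phi> (z (Suc i)) - \<phi> (z i)\<bar> \<le> (1 / real m) * (h \<bullet> (F (z (Suc i)) - F (z i)))"
        using ineq[OF zX zX, of "Suc i" i] Suc.prems by simp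
      then have "real m * \<bar>\<phi> (z (Suc i)) - \<phi> (z i)\<bar> \<le> h \<bullet> (F (z (Suc i)) - F (z i))"
        using m by (simp add: field_simps)
      moreover have "real m * \<bar>\<phi> (z i) - \<phi> x\<bar> \<le> h \<bullet> (F (z i) - F x)" using Suc by simp
      moreover have "real m * \<bar>\<phi> (z (Suc i)) - \<phi> x\<bar> \<le>
          real m * \<bar>\<phi> (z (Suc i)) - \<phi> (z i)\<bar> + real m * \<bar>\<phi> (z i) - \<phi> x\<bar>"
        unfolding distrib_left[symmetric] by (intro mult_left_mono) auto
      ultimately show ?case by (simp add: inner_diff_right)
    qed
    from this[of m] m show ?thesis by (simp add: z_def h_def)
  qed
  obtain m :: nat where m: "h \<bullet> (F y - F x) < real m * \<bar>\<phi> y - \<phi> x\<bar>"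
    using reals_Archimedean3[of "\<bar>\<phi> y - \<phi> x\<bar>"] ne by auto
  \<comment> \<open>The subdivision in \<open>bound\<close> needs a positive number of steps, hence
    the passage to \<open>Suc m\<close>.\<close>
  have "h \<bullet> (F y - F x) < real (Suc m) * \<bar>\<phi> y - \<phi> x\<bar>"
    using m by (simp add: distrib_right)
  then show False using bound[of "Suc m"] by simp
qed

text \<open>Maximality inequalities replace differentiation of the support function: increments of
  \<open>\<phi>\<close> are bounded by inner products of increments of \<open>w\<close> and
  \<open>P w\<close>, and such a function is constant on a convex set.\<close>

lemma (in smooth_convex_body) chord_midpoints_coplanar:
  assumes \<nu>: "norm \<nu> = 1" and N: "N \<bullet> \<nu> = 1"
    and refl: "\<And>p q t. p \<in> frontier D \<Longrightarrow> q \<in> frontier D \<Longrightarrow> t > 0 \<Longrightarrow> p - q = t *\<^sub>R \<nu> \<Longrightarrow>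
      exterior_normal D q = sgn (exterior_normal D p - (2 * (exterior_normal D p \<bullet> \<nu>)) *\<^sub>R N)"
  shows "\<exists>c. \<forall>p\<in>frontier D. \<forall>q\<in>frontier D. \<forall>t>0. p - q = t *\<^sub>R \<nu> \<longrightarrow> N \<bullet> (p + q) = 2 * c"
proof -
  have \<nu>\<nu>: "\<nu> \<bullet> \<nu> = 1" using \<nu> by (simp add: dot_square_norm)
  define A where "A u = u - (2 * (u \<bullet> \<nu>)) *\<^sub>R N" for u
  have A_scale: "A (r *\<^sub>R u) = r *\<^sub>R A u" for r u by (simp add: A_def scaleR_diff_right)
  have A_\<nu>: "A u \<bullet> \<nu> = - (u \<bullet> \<nu>)" for u using N by (simp add: A_def inner_diff_left)
  \<comment> \<open>\<open>P u\<close> is the frontier point with outer normal in direction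
    \<open>u\<close>. The support function is \<open>u \<bullet> P u\<close>, and \<open>P\<close>
    plays the role of its gradient.\<close>
  define P where "P u = (SOME p. p \<in> frontier D \<and> exterior_normal D p = sgn u)" for u
  have P: "P u \<in> frontier D" "exterior_normal D (P u) = sgn u" if "u \<noteq> 0" for u
    using someI_ex[of "\<lambda>p. p \<in> frontier D \<and> exterior_normal D p = sgn u"] Gauss_map_surj[OF that]
    unfolding P_def by blast+
  have P_eq: "P u = p" if "u \<noteq> 0" "p \<in> frontier D" "exterior_normal D p = sgn u" for u p
    using normal_inj[OF P(1)[OF that(1)] that(2)] P(2)[OF that(1)] that(3) by simp
  have P_max: "u \<bullet> P v \<le> u \<bullet> P u" if "u \<noteq> 0" "v \<noteq> 0" for u v
  proof -
    have "P v \<in> closure D" using P(1)[OF that(2)] frontier_subset by blast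
    from normal_supports[OF P(1)[OF that(1)] this] P(2)[OF that(1)]
    have "sgn u \<bullet> P v \<le> sgn u \<bullet> P u" by simp
    then have "norm u * (sgn u \<bullet> P v) \<le> norm u * (sgn u \<bullet> P u)" by (rule mult_left_mono) simp
    then show ?thesis using that(1) by (simp add: sgn_div_norm)
  qed
  \<comment> \<open>Each vector with positive \<open>\<nu>\<close>-component has exactly one
    positive multiple in this slice, and on it \<open>A w - A u = w - u\<close>.\<close>
  define X where "X = {w. w \<bullet> \<nu> = 1}"
  have ne: "w \<noteq> 0" "A w \<noteq> 0" if "w \<in> X" for w
    using that A_\<nu>[of w] by (auto simp: X_def)
  have sgnA: "sgn (A (r *\<^sub>R w)) = sgn (A w)" if "r > 0" for r w
    using that by (simp add: A_scale sgn_scaleR)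
  \<comment> \<open>\<open>refl\<close> gives the normal at the far end of the chord from
    \<open>P w\<close> in direction \<open>- \<nu>\<close>. Since the Gauss map is injective, that
    end is \<open>P (A w)\<close>.\<close>
  have partner: "\<exists>t>0. P (A w) = P w - t *\<^sub>R \<nu>" if w: "w \<in> X" for w
  proof -
    have sw: "sgn w = (1 / norm w) *\<^sub>R w" by (simp add: sgn_div_norm divide_inverse)
    have "sgn w \<bullet> \<nu> > 0" using w ne(1)[OF w] by (simp add: sw X_def)
    then have "exterior_normal D (P w) \<bullet> (- \<nu>) < 0" using P(2)[OF ne(1)[OF w]] by simp
    then obtain t where t: "t > 0" "P w + t *\<^sub>R (- \<nu>) \<in> frontier D"
      using second_intersection[OF P(1)[OF ne(1)[OF w]]] by blast
    then have q: "P w - t *\<^sub>R \<nu> \<in> frontier D" by simp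
    have "exterior_normal D (P w - t *\<^sub>R \<nu>) = sgn (A (sgn w))"
      unfolding A_def P(2)[OF ne(1)[OF w], symmetric]
      by (rule refl[OF P(1)[OF ne(1)[OF w]] q t(1)]) simp
    also have "\<dots> = sgn (A w)" unfolding sw by (rule sgnA) (use ne(1)[OF w] in simp)
    finally show ?thesis using P_eq[OF ne(2)[OF w] q] t(1) by blast
  qed
  define \<phi> where "\<phi> w = A w \<bullet> P (A w) - w \<bullet> P w" for w
  have \<phi>_mid: "\<phi> w = - (N \<bullet> (P w + P (A w)))" if w: "w \<in> X" for w
  proof -
    obtain t where t: "P (A w) = P w - t *\<^sub>R \<nu>" using partner[OF w] by blast
    have "\<phi> w = A w \<bullet> P w - t * (A w \<bullet> \<nu>) - w \<bullet> P w"
      by (simp add: \<phi>_def t inner_diff_right)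
    also have "\<dots> = t - 2 * (N \<bullet> P w)"
      using w unfolding A_\<nu> by (simp add: A_def X_def inner_diff_left)
    also have "\<dots> = - (N \<bullet> (P w + P (A w)))"
      using N by (simp add: t inner_add_right inner_diff_right)
    finally show ?thesis .
  qed
  txt \<open>\<open>\<phi>\<close> is the difference \<open>H \<circ> A - H\<close> of support functions; the two inequalities are the
    maximality of \<open>P (A w)\<close> and \<open>P u\<close>.\<close>
  have half: "\<phi> u - \<phi> w \<le> (w - u) \<bullet> (P w - P u)" if u: "u \<in> X" and w: "w \<in> X" for u w
  proof -
    have Aw: "A w = A u + (w - u)" using u w by (simp add: A_def X_def)
    have 1: "A w \<bullet> P (A u) \<le> A w \<bullet> P (A w)" and 2: "u \<bullet> P w \<le> u \<bullet> P u"
      using P_max ne u w by auto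
    obtain t where t: "P (A u) = P u - t *\<^sub>R \<nu>" using partner[OF u] by blast
    \<comment> \<open>Differences in the slice are orthogonal to the chord direction, so they do not
      distinguish \<open>P (A u)\<close> from \<open>P u\<close>.\<close>
    have "(w - u) \<bullet> \<nu> = 0" using u w by (simp add: X_def inner_diff_left)
    then have "(w - u) \<bullet> P (A u) = (w - u) \<bullet> P u" unfolding t by (simp add: inner_diff_right)
    then have "A w \<bullet> P (A u) = A u \<bullet> P (A u) + (w - u) \<bullet> P u"
      unfolding Aw by (simp only: inner_add_left)
    then show ?thesis using 1 2
      by (simp add: \<phi>_def inner_diff_left inner_diff_right)
  qed
  have "convex X" unfolding X_def using convex_hyperplane[of \<nu> 1] by (simp add: inner_commute)
  have \<phi>_const: "\<phi> u = \<phi> w" if "u \<in> X" "w \<in> X" for u w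
  proof (rule constant_if_abs_diff_le_inner[OF \<open>convex X\<close> _ that, where F = P])
    fix x y assume "x \<in> X" "y \<in> X"
    then show "\<bar>\<phi> x - \<phi> y\<bar> \<le> (x - y) \<bullet> (P x - P y)"
      using half[of x y] half[of y x] by (simp add: inner_diff_left inner_diff_right abs_le_iff)
  qed
  have "\<nu> \<in> X" using \<nu>\<nu> by (simp add: X_def)
  show ?thesis
  \<comment> \<open>By \<open>\<phi>_mid\<close> the constant value of \<open>\<phi>\<close> is
    \<open>- (N \<bullet> (p + q))\<close>; it is evaluated at the base point \<open>\<nu>\<close>
    of the slice.\<close>
  proof (intro exI[of _ "- \<phi> \<nu> / 2"] ballI allI impI)
    fix p q t assume pq: "p \<in> frontier D" "q \<in> frontier D" "(t::real) > 0" "p - q = t *\<^sub>R \<nu>"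
    define n where "n = exterior_normal D p"
    have "q \<noteq> p" using pq(3,4) \<nu> by auto
    moreover have "q \<in> closure D" using pq(2) frontier_subset by blast
    ultimately have "n \<bullet> (p - q) > 0"
      using normal_supports_strictly[OF pq(1)] by (simp add: n_def inner_diff_right)
    then have n\<nu>: "n \<bullet> \<nu> > 0" using pq(3,4) by (simp add: zero_less_mult_iff)
    define w where "w = (1 / (n \<bullet> \<nu>)) *\<^sub>R n"
    have wX: "w \<in> X" using n\<nu> by (simp add: w_def X_def)
    have "norm n = 1" using norm_normal[OF pq(1)] by (simp add: n_def)
    then have "sgn w = n" using n\<nu> by (simp add: w_def sgn_scaleR sgn_div_norm[of n])
    then have "P w = p" using P_eq[OF ne(1)[OF wX] pq(1)] by (simp add: n_def)
    have "exterior_normal D q = sgn (A n)" unfolding A_def n_def by (rule refl[OF pq])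
    also have "\<dots> = sgn (A w)" unfolding w_def by (rule sgnA[symmetric]) (use n\<nu> in simp)
    finally have "P (A w) = q" using P_eq[OF ne(2)[OF wX] pq(2)] by blast
    then show "N \<bullet> (p + q) = 2 * (- \<phi> \<nu> / 2)"
      using \<phi>_const[OF wX \<open>\<nu> \<in> X\<close>] \<phi>_mid[OF wX] \<open>P w = p\<close> by simp
  qed
qed

theorem theorem1p10:
  fixes K T :: "(real^'n) set"
  assumes "open K" "bounded K" "K \<noteq> {}" "strictly_convex K" "Ck_boundary 6 K"
    and "open T" "bounded T" "T \<noteq> {}" "strictly_convex T" "Ck_boundary 6 T"
    and "closed (frontier T)"
    and "\<forall>p\<in>frontier T. second_fundamental_form_pos_def T p"
    and "\<exists>N. transversal_line_field (frontier K) N \<and>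
           (\<forall>q\<in>frontier K. \<forall>L. directed_out K q L \<longrightarrow>
              T_billiard_reflection T K q L =
                oline_image (projective_involution (frontier K) N q) L)"
  shows "ellipsoid (frontier T)"
proof -
  \<comment> \<open>Brings the smoothness order into the shape \<open>Suc k\<close> required by the
    locale.\<close>
  have six: "6 = Suc 5" by simp
  interpret K: smooth_convex_body K 5
    using assms(1-5) unfolding six by unfold_locales
  interpret T: smooth_convex_body T 5
    using assms(6-10) unfolding six by unfold_locales
  obtain \<N> where \<N>: "transversal_line_field (frontier K) \<N>"
    and refl: "\<And>q L. q \<in> frontier K \<Longrightarrow> directed_out K q L \<Longrightarrow>
      T_billiard_reflection T K q L = oline_image (projective_involution (frontier K) \<N> q) L"
    using assms(13) by blast
  show ?thesis
  proof (rule ellipsoid_if_chord_midpoints_coplanar[OF assms(6-8) T.convex_D])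
    fix \<nu> :: "real^'n" assume \<nu>: "norm \<nu> = 1"
    then have "\<nu> \<noteq> 0" "sgn \<nu> = \<nu>" by (auto simp: sgn_div_norm)
    \<comment> \<open>Every direction occurs as a normal of \<open>K\<close>, so the hypothesis on
      \<open>K\<close> yields information about the chords of \<open>T\<close> in every
      direction.\<close>
    then obtain q where q: "q \<in> frontier K" and n: "exterior_normal K q = \<nu>"
      using K.Gauss_map_surj[of \<nu>] by auto
    obtain v where v: "v \<notin> tangent_space (frontier K) q" "\<N> q = line_through q v"
      using \<N> q unfolding transversal_line_field_def by blast
    define B where "B = projective_involution (frontier K) \<N> q"
    obtain N where N: "N \<bullet> \<nu> = 1" "\<And>u. B u - B 0 = u - (2 * (u \<bullet> \<nu>)) *\<^sub>R N"
      unfolding B_def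
      using projective_involution_linear_part[where C="frontier K" and q=q and \<nu>=\<nu> and \<N>=\<N> and v=v]
        K.tangent_space_normal[OF q, unfolded n] v by blast
    have "\<exists>c. \<forall>p\<in>frontier T. \<forall>q\<in>frontier T. \<forall>t>0. p - q = t *\<^sub>R \<nu> \<longrightarrow> N \<bullet> (p + q) = 2 * c"
    proof (rule T.chord_midpoints_coplanar[OF \<nu> N(1)])
      fix p0 p1 t assume p: "p0 \<in> frontier T" "p1 \<in> frontier T" "(t::real) > 0" "p0 - p1 = t *\<^sub>R \<nu>"
      let ?n = "exterior_normal T"
      let ?L = "oline_through q (?n p0)"
      have norms: "norm (?n p0) = 1" "norm (?n p1) = 1" using p T.norm_normal by auto
      then have L: "snd ?L = ?n p0" by (simp add: oline_through_def sgn_div_norm)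
      have "p1 \<noteq> p0" using p(3,4) \<nu> by auto
      moreover have "p1 \<in> closure T" using p(2) T.frontier_subset by blast
      ultimately have "?n p0 \<bullet> (p0 - p1) > 0"
        using T.normal_supports_strictly[OF p(1)] by (simp add: inner_diff_right)
      then have "?n p0 \<bullet> \<nu> > 0" using p(3,4) by (simp add: zero_less_mult_iff)
      moreover have "?n p0 \<noteq> 0" using norms by auto
      ultimately have "directed_out K q ?L"
        unfolding directed_out_def L n olines_at_def by blast
      then have "oline_image B ?L = T_billiard_reflection T K q ?L"
        unfolding B_def by (rule refl[OF q, symmetric])
      also have "\<dots> = oline_through q (?n p1)"
        by (rule T.T_billiard_reflection_chord[OF p(1-3)]) (use p(4) n \<open>\<nu> \<noteq> 0\<close> in auto)
      \<comment> \<open>Both lines pass through \<open>q\<close>; only their directions carry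
        information about \<open>T\<close>.\<close>
      finally have "snd (oline_image B ?L) = snd (oline_through q (?n p1))" by simp
      then show "?n p1 = sgn (?n p0 - (2 * (?n p0 \<bullet> \<nu>)) *\<^sub>R N)"
        using norms unfolding oline_image_def snd_conv L N(2)
        by (simp add: oline_through_def sgn_div_norm[of "?n p1"])
    qed
    then show "\<exists>N c. N \<bullet> \<nu> = 1 \<and>
        (\<forall>p\<in>frontier T. \<forall>q\<in>frontier T. \<forall>t>0. p - q = t *\<^sub>R \<nu> \<longrightarrow> N \<bullet> (p + q) = 2 * c)"
      using N(1) by blast
  qed
qed

end
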